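(* Let $\{u^{(l)}\}_{l\in\mathbb N_0}$ be defined by $u^{(0)}\equiv0$ and, for $l\ge1$, $u^{(l)}\in H^1(\Omega)$ is the solution of $$\mathcal A(u^{(l-1)};u^{(l)},v)=-k^2\varepsilon(|u^{(l-1)}|^2u^{(l-1)},v)_D+(f,v)+(g,v)_\Gamma\qquad\text{for all }v\in H^1(\Omega),$$ where $$\mathcal A(\Phi;v,w)=(\nabla v,\nabla w)-(k^2(1+2\chi_D\varepsilon|\Phi|^2)v,w)+ik(v,w)_\Gamma .$$ Let $\theta_1,C_1,C_\infty>0$ be the constants described in the context. If $$C_1C_\infty^2\,k^{d-2}\,\varepsilon\,C_{\mathrm{data}}^2\le q(1-q)^2$$ for some $q<\min\{\tfrac16,\tfrac{C_1\theta_1}{2}\}$, then $$\|u^{(l+1)}-u^{(l)}\|_{1,k}\le\tfrac12\|u^{(l)}-u^{(l-1)}\|_{1,k}\qquad\text{for all }l\ge1,$$ and the sequence $\{u^{(l)}\}_l$ converges linearly to the solution $u\in H^1(\Omega)$ of the nonlinear Helmholtz problem $$(\nabla u,\nabla v)-(k^2(1+\chi_D\varepsilon|u|^2)u,v)+ik(u,v)_\Gamma=(f,v)+(g,v)_\Gamma\qquad\text{for all }v\in H^1(\Omega).$$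
   Context: Setting. $\Omega\subset\mathbb R^d$, $d\in\{2,3\}$, is a bounded star-shaped domain with analytic boundary $\Gamma=\partial\Omega$; $D\subset\subset\Omega$ is a non-empty compactly embedded subdomain with Lipschitz boundary and $\chi_D$ is its characteristic function. $f\in L^2(\Omega)$, $g\in H^{1/2}(\Gamma)$, $\varepsilon>0$ is a real number, and the wave number satisfies $k\ge k_0$ for a fixed $k_0>0$. All functions are complex-valued; $(\cdot,\cdot)_S$ is the complex $L^2(S)$ scalar product (conjugate in the second argument), the index being omitted for $S=\Omega$. Norms: $\|\cdot\|_0=\|\cdot\|_{L^2(\Omega)}$, $\|v\|_{1,k}^2=\|\nabla v\|_0^2+k^2\|v\|_0^2$, $\|\cdot\|_2=\|\cdot\|_{H^2(\Omega)}$. Set $C_{\mathrm{data}}=\|f\|_0+\|g\|_{H^{1/2}(\Gamma)}$. It is assumed (well established for star-shaped $\Omega$) that the linear problem with $\varepsilon=0$ has a $k$-independent stability constant. Constants $\theta_1,C_1,C_2,C_\infty$ (known from earlier work, independent of $k$, $\varepsilon$, $\Phi$ and the data): for every $\Phi\in H^1(\Omega)\cap L^\infty(D)$ with $k\varepsilon\|\Phi\|_{L^\infty(D)}^2\le\theta_1$ and all data $f\in L^2(\Omega)$, $g\in H^{1/2}(\Gamma)$, the linearized problem of finding $w\in H^1(\Omega)$ with $(\nabla w,\nabla v)-k^2((1+\chi_D\varepsilon|\Phi|^2)w,v)+ik(w,v)_\Gamma=(f,v)+(g,v)_\Gamma$ for all $v\in H^1(\Omega)$ has a unique solution, and it satisfies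 $\|w\|_{1,k}\le C_1C_{\mathrm{data}}$, $\|w\|_2\le C_2kC_{\mathrm{data}}$, $\|w\|_{L^\infty(D)}\le C_\infty k^{(d-3)/2}C_{\mathrm{data}}$ (with $C_{\mathrm{data}}$ formed from the data of that problem). The solution $u$. It is known from earlier work that there is a constant $\theta_0>0$ such that if $k^{d-2}\varepsilon C_{\mathrm{data}}^2<\theta_0$ there is a unique solution $u\in H^1(\Omega)$ of the nonlinear problem, and that it satisfies, with constants independent of $k$, $\|u\|_{1,k}\lesssim C_{\mathrm{data}}$, $\|u\|_2\lesssim kC_{\mathrm{data}}$, $\|u\|_{L^\infty(D)}\lesssim k^{(d-3)/2}C_{\mathrm{data}}$; "the solution $u$" refers to this one. *)

theory Defs
  imports "HOL-Analysis.Analysis" "HOL-Probability.Essential_Supremum"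
begin

section \<open>Lebesgue spaces\<close>

text \<open>Elements of function spaces are representatives; identities between them are meant
  almost everywhere.\<close>

definition L2 :: "'a measure \<Rightarrow> ('a \<Rightarrow> 'b::euclidean_space) set" where
  "L2 M = {f \<in> borel_measurable M. integrable M (\<lambda>x. (norm (f x))\<^sup>2)}"

definition L2_ip :: "'a measure \<Rightarrow> ('a \<Rightarrow> complex) \<Rightarrow> ('a \<Rightarrow> complex) \<Rightarrow> complex" where
  "L2_ip M f g = (LINT x|M. f x * cnj (g x))"

definition L2_norm :: "'a measure \<Rightarrow> ('a \<Rightarrow> 'b::euclidean_space) \<Rightarrow> real" where
  "L2_norm M f = sqrt (LINT x|M. (norm (f x))\<^sup>2)"

definition Linf :: "'a measure \<Rightarrow> ('a \<Rightarrow> complex) set" where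
  "Linf M = {f \<in> borel_measurable M. esssup M (\<lambda>x. ereal (cmod (f x))) < \<infinity>}"

definition Linf_norm :: "'a measure \<Rightarrow> ('a \<Rightarrow> complex) \<Rightarrow> real" where
  "Linf_norm M f = real_of_ereal (esssup M (\<lambda>x. ereal (cmod (f x))))"


section \<open>Smooth functions and weak derivatives\<close>

definition partial :: "'n \<Rightarrow> (real ^ 'n::finite \<Rightarrow> 'b::real_normed_vector) \<Rightarrow> real ^ 'n \<Rightarrow> 'b" where
  "partial i f x = frechet_derivative f (at x) (axis i 1)"

text \<open>\<open>C\<^sup>\<infinity>\<close> on the whole space: all iterated partial derivatives exist and are
  (Frechet) differentiable.\<close>

definition smooth :: "(real ^ 'n::finite \<Rightarrow> 'b::real_normed_vector) \<Rightarrow> bool" where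
  "smooth f \<longleftrightarrow> (\<forall>js. \<forall>x. foldr partial js f differentiable (at x))"

definition test_function :: "(real ^ 'n::finite) set \<Rightarrow> (real ^ 'n \<Rightarrow> real) \<Rightarrow> bool" where
  "test_function \<Omega> \<phi> \<longleftrightarrow>
     smooth \<phi> \<and> (\<exists>K. compact K \<and> K \<subseteq> \<Omega> \<and> (\<forall>x. x \<notin> K \<longrightarrow> \<phi> x = 0))"

definition is_weak_gradient ::
  "(real ^ 'n::finite) set \<Rightarrow> (real ^ 'n \<Rightarrow> complex) \<Rightarrow> (real ^ 'n \<Rightarrow> complex ^ 'n) \<Rightarrow> bool" where
  "is_weak_gradient \<Omega> u G \<longleftrightarrow>
     G \<in> L2 (lebesgue_on \<Omega>) \<and>
     (\<forall>\<phi> i. test_function \<Omega> \<phi> \<longrightarrow>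
        (LINT x|lebesgue_on \<Omega>. partial i \<phi> x *\<^sub>R u x) =
        - (LINT x|lebesgue_on \<Omega>. \<phi> x *\<^sub>R (G x $ i)))"

definition H1 :: "(real ^ 'n::finite) set \<Rightarrow> (real ^ 'n \<Rightarrow> complex) set" where
  "H1 \<Omega> = {u \<in> L2 (lebesgue_on \<Omega>). \<exists>G. is_weak_gradient \<Omega> u G}"

definition wgrad ::
  "(real ^ 'n::finite) set \<Rightarrow> (real ^ 'n \<Rightarrow> complex) \<Rightarrow> real ^ 'n \<Rightarrow> complex ^ 'n" where
  "wgrad \<Omega> u = (SOME G. is_weak_gradient \<Omega> u G)"

definition grad_ip ::
  "(real ^ 'n::finite) set \<Rightarrow> (real ^ 'n \<Rightarrow> complex) \<Rightarrow> (real ^ 'n \<Rightarrow> complex) \<Rightarrow> complex" where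
  "grad_ip \<Omega> v w = (LINT x|lebesgue_on \<Omega>. (\<Sum>i\<in>UNIV. (wgrad \<Omega> v x $ i) * cnj (wgrad \<Omega> w x $ i)))"

text \<open>The weighted norm \<open>\<parallel>v\<parallel>\<^sub>1\<^sub>,\<^sub>k\<close>; for \<open>k = 1\<close> it is the usual norm of \<open>H\<^sup>1\<close>.\<close>

definition H1k_norm :: "(real ^ 'n::finite) set \<Rightarrow> real \<Rightarrow> (real ^ 'n \<Rightarrow> complex) \<Rightarrow> real" where
  "H1k_norm \<Omega> k v =
     sqrt ((L2_norm (lebesgue_on \<Omega>) (wgrad \<Omega> v))\<^sup>2 + k\<^sup>2 * (L2_norm (lebesgue_on \<Omega>) v)\<^sup>2)"

definition H2 :: "(real ^ 'n::finite) set \<Rightarrow> (real ^ 'n \<Rightarrow> complex) set" where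
  "H2 \<Omega> = {u \<in> H1 \<Omega>. \<forall>i. (\<lambda>x. wgrad \<Omega> u x $ i) \<in> H1 \<Omega>}"

definition H2_norm :: "(real ^ 'n::finite) set \<Rightarrow> (real ^ 'n \<Rightarrow> complex) \<Rightarrow> real" where
  "H2_norm \<Omega> u =
     sqrt ((L2_norm (lebesgue_on \<Omega>) u)\<^sup>2 + (L2_norm (lebesgue_on \<Omega>) (wgrad \<Omega> u))\<^sup>2 +
           (\<Sum>i\<in>UNIV. (L2_norm (lebesgue_on \<Omega>) (wgrad \<Omega> (\<lambda>x. wgrad \<Omega> u x $ i)))\<^sup>2))"


section \<open>Regularity of the boundary\<close>

text \<open>The boundary is locally a graph in some direction \<open>\<nu>\<close>, with the set on one side of it.
  The map \<open>x \<mapsto> x - (x \<bullet> \<nu>) \<nu>\<close> is the orthogonal projection onto the hyperplane \<open>\<nu>\<^sup>\<bottom>\<close>;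
  the predicate \<open>P \<gamma> V\<close> prescribes the regularity of the graph function \<open>\<gamma>\<close> on the set \<open>V\<close> of
  projected points.\<close>

definition graph_boundary ::
  "((real ^ 'n::finite \<Rightarrow> real) \<Rightarrow> (real ^ 'n) set \<Rightarrow> bool) \<Rightarrow> (real ^ 'n) set \<Rightarrow> bool" where
  "graph_boundary P S \<longleftrightarrow>
     (\<forall>p\<in>frontier S. \<exists>U \<nu> \<gamma>. open U \<and> p \<in> U \<and> norm \<nu> = 1 \<and>
        P \<gamma> ((\<lambda>x. x - (x \<bullet> \<nu>) *\<^sub>R \<nu>) ` U) \<and>
        S \<inter> U = {x \<in> U. x \<bullet> \<nu> < \<gamma> (x - (x \<bullet> \<nu>) *\<^sub>R \<nu>)})"

text \<open>Power series in several variables, indexed by multi-indices \<open>\<alpha>\<close> and summed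
  unconditionally.\<close>

definition real_analytic_at :: "(real ^ 'n::finite \<Rightarrow> real) \<Rightarrow> real ^ 'n \<Rightarrow> bool" where
  "real_analytic_at f x \<longleftrightarrow>
     (\<exists>(a :: ('n \<Rightarrow> nat) \<Rightarrow> real) r. r > 0 \<and>
        (\<forall>y\<in>ball x r. ((\<lambda>\<alpha>. a \<alpha> * (\<Prod>i\<in>UNIV. (y $ i - x $ i) ^ \<alpha> i)) has_sum f y) UNIV))"

definition analytic_boundary :: "(real ^ 'n::finite) set \<Rightarrow> bool" where
  "analytic_boundary S \<longleftrightarrow> graph_boundary (\<lambda>\<gamma> V. \<forall>x\<in>V. real_analytic_at \<gamma> x) S"

definition lipschitz_boundary :: "(real ^ 'n::finite) set \<Rightarrow> bool" where
  "lipschitz_boundary S \<longleftrightarrow> graph_boundary (\<lambda>\<gamma> V. \<exists>L. L-lipschitz_on V \<gamma>) S"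


section \<open>Surface measure, traces, and the trace space\<close>

text \<open>Hausdorff measure of dimension \<open>s > 0\<close>, normalised so that it agrees with the surface
  measure on \<open>s\<close>-dimensional \<open>C\<^sup>1\<close> surfaces.\<close>

definition hausdorff_outer :: "real \<Rightarrow> (real ^ 'n::finite) set \<Rightarrow> ennreal" where
  "hausdorff_outer s A =
     (SUP \<delta>\<in>{0<..}.
        INF C\<in>{C :: nat \<Rightarrow> (real ^ 'n) set.
                A \<subseteq> (\<Union>j. C j) \<and> (\<forall>j. bounded (C j) \<and> diameter (C j) \<le> \<delta>)}.
          (\<Sum>j. ennreal (unit_ball_vol s * (diameter (C j) / 2) powr s)))"

definition surface_measure :: "(real ^ 'n::finite) set \<Rightarrow> (real ^ 'n) measure" where
  "surface_measure \<Gamma> =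
     restrict_space (measure_of UNIV (sets borel) (hausdorff_outer (real CARD('n) - 1))) \<Gamma>"

abbreviation bdry :: "(real ^ 'n::finite) set \<Rightarrow> (real ^ 'n) measure" where
  "bdry \<Omega> \<equiv> surface_measure (frontier \<Omega>)"

text \<open>The trace operator is the continuous extension to \<open>H\<^sup>1\<close> of the restriction to the boundary of
  functions smooth up to the boundary; \<open>has_trace \<Omega> v t\<close> is its graph.  By the trace theorem and
  the density of smooth functions, on a bounded domain with Lipschitz boundary every \<open>v\<close> in \<open>H\<^sup>1\<close>
  has a trace, and it is unique up to null sets.\<close>

definition has_trace ::
  "(real ^ 'n::finite) set \<Rightarrow> (real ^ 'n \<Rightarrow> complex) \<Rightarrow> (real ^ 'n \<Rightarrow> complex) \<Rightarrow> bool" where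
  "has_trace \<Omega> v t \<longleftrightarrow>
     v \<in> H1 \<Omega> \<and> t \<in> L2 (bdry \<Omega>) \<and>
     (\<exists>\<phi> :: nat \<Rightarrow> real ^ 'n \<Rightarrow> complex.
        (\<forall>j. smooth (\<phi> j) \<and> \<phi> j \<in> H1 \<Omega> \<and> \<phi> j \<in> L2 (bdry \<Omega>)) \<and>
        (\<lambda>j. H1k_norm \<Omega> 1 (\<lambda>x. \<phi> j x - v x)) \<longlonglongrightarrow> 0 \<and>
        (\<lambda>j. L2_norm (bdry \<Omega>) (\<lambda>x. \<phi> j x - t x)) \<longlonglongrightarrow> 0)"

text \<open>Squared Sobolev--Slobodeckij seminorm of \<open>H\<^sup>1\<^sup>/\<^sup>2\<close> on the \<open>(d - 1)\<close>-dimensional boundary: the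
  exponent of the kernel is \<open>(d - 1) + 2 \<cdot> 1/2 = d\<close>.\<close>

definition slobodeckij_sq :: "(real ^ 'n::finite) set \<Rightarrow> (real ^ 'n \<Rightarrow> complex) \<Rightarrow> ennreal" where
  "slobodeckij_sq \<Omega> g =
     (\<integral>\<^sup>+x. (\<integral>\<^sup>+y. ennreal ((cmod (g x - g y))\<^sup>2 / dist x y ^ CARD('n)) \<partial>bdry \<Omega>) \<partial>bdry \<Omega>)"

definition Hhalf :: "(real ^ 'n::finite) set \<Rightarrow> (real ^ 'n \<Rightarrow> complex) set" where
  "Hhalf \<Omega> = {g \<in> L2 (bdry \<Omega>). slobodeckij_sq \<Omega> g < \<infinity>}"

definition Hhalf_norm :: "(real ^ 'n::finite) set \<Rightarrow> (real ^ 'n \<Rightarrow> complex) \<Rightarrow> real" where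
  "Hhalf_norm \<Omega> g = sqrt ((L2_norm (bdry \<Omega>) g)\<^sup>2 + enn2real (slobodeckij_sq \<Omega> g))"

definition C_data ::
  "(real ^ 'n::finite) set \<Rightarrow> (real ^ 'n \<Rightarrow> complex) \<Rightarrow> (real ^ 'n \<Rightarrow> complex) \<Rightarrow> real" where
  "C_data \<Omega> f g = L2_norm (lebesgue_on \<Omega>) f + Hhalf_norm \<Omega> g"


section \<open>Weak Helmholtz problems with impedance boundary condition\<close>

text \<open>\<open>helm_form \<Omega> D k \<epsilon> c \<Phi> v tv w tw\<close> is
  \<open>(\<nabla>v, \<nabla>w) - (k\<^sup>2 (1 + c \<chi>\<^sub>D \<epsilon> \<bar>\<Phi>\<bar>\<^sup>2) v, w) + i k (v, w)\<^sub>\<Gamma>\<close>, where \<open>tv\<close> and \<open>tw\<close> are the traces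
  of \<open>v\<close> and \<open>w\<close>.  The form \<open>\<A>(\<Phi>; v, w)\<close> of the iteration is the case \<open>c = 2\<close>; the linearized
  and the nonlinear problem use \<open>c = 1\<close>.\<close>

definition helm_form ::
  "(real ^ 'n::finite) set \<Rightarrow> (real ^ 'n) set \<Rightarrow> real \<Rightarrow> real \<Rightarrow> real \<Rightarrow> (real ^ 'n \<Rightarrow> complex) \<Rightarrow>
   (real ^ 'n \<Rightarrow> complex) \<Rightarrow> (real ^ 'n \<Rightarrow> complex) \<Rightarrow>
   (real ^ 'n \<Rightarrow> complex) \<Rightarrow> (real ^ 'n \<Rightarrow> complex) \<Rightarrow> complex" where
  "helm_form \<Omega> D k \<epsilon> c \<Phi> v tv w tw =
     grad_ip \<Omega> v w
     - L2_ip (lebesgue_on \<Omega>)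
         (\<lambda>x. complex_of_real (k\<^sup>2 * (1 + c * indicator D x * \<epsilon> * (cmod (\<Phi> x))\<^sup>2)) * v x) w
     + \<i> * complex_of_real k * L2_ip (bdry \<Omega>) tv tw"

text \<open>\<open>F v s\<close> is the value of the right-hand side at a test function \<open>v\<close> with trace \<open>s\<close>.\<close>

definition helm_solves ::
  "(real ^ 'n::finite) set \<Rightarrow> (real ^ 'n) set \<Rightarrow> real \<Rightarrow> real \<Rightarrow> real \<Rightarrow> (real ^ 'n \<Rightarrow> complex) \<Rightarrow>
   ((real ^ 'n \<Rightarrow> complex) \<Rightarrow> (real ^ 'n \<Rightarrow> complex) \<Rightarrow> complex) \<Rightarrow> (real ^ 'n \<Rightarrow> complex) \<Rightarrow> bool" where
  "helm_solves \<Omega> D k \<epsilon> c \<Phi> F w \<longleftrightarrow>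
     w \<in> H1 \<Omega> \<and>
     (\<exists>t. has_trace \<Omega> w t \<and>
        (\<forall>v\<in>H1 \<Omega>. \<forall>s. has_trace \<Omega> v s \<longrightarrow> helm_form \<Omega> D k \<epsilon> c \<Phi> w t v s = F v s))"

definition data_rhs ::
  "(real ^ 'n::finite) set \<Rightarrow> (real ^ 'n \<Rightarrow> complex) \<Rightarrow> (real ^ 'n \<Rightarrow> complex) \<Rightarrow>
   (real ^ 'n \<Rightarrow> complex) \<Rightarrow> (real ^ 'n \<Rightarrow> complex) \<Rightarrow> complex" where
  "data_rhs \<Omega> f g v s = L2_ip (lebesgue_on \<Omega>) f v + L2_ip (bdry \<Omega>) g s"

definition linearized_solution ::
  "(real ^ 'n::finite) set \<Rightarrow> (real ^ 'n) set \<Rightarrow> real \<Rightarrow> real \<Rightarrow> (real ^ 'n \<Rightarrow> complex) \<Rightarrow>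
   (real ^ 'n \<Rightarrow> complex) \<Rightarrow> (real ^ 'n \<Rightarrow> complex) \<Rightarrow> (real ^ 'n \<Rightarrow> complex) \<Rightarrow> bool" where
  "linearized_solution \<Omega> D k \<epsilon> \<Phi> f g w \<longleftrightarrow> helm_solves \<Omega> D k \<epsilon> 1 \<Phi> (data_rhs \<Omega> f g) w"

definition nonlinear_solution ::
  "(real ^ 'n::finite) set \<Rightarrow> (real ^ 'n) set \<Rightarrow> real \<Rightarrow> real \<Rightarrow>
   (real ^ 'n \<Rightarrow> complex) \<Rightarrow> (real ^ 'n \<Rightarrow> complex) \<Rightarrow> (real ^ 'n \<Rightarrow> complex) \<Rightarrow> bool" where
  "nonlinear_solution \<Omega> D k \<epsilon> f g u \<longleftrightarrow> helm_solves \<Omega> D k \<epsilon> 1 u (data_rhs \<Omega> f g) u"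

definition iteration_step ::
  "(real ^ 'n::finite) set \<Rightarrow> (real ^ 'n) set \<Rightarrow> real \<Rightarrow> real \<Rightarrow>
   (real ^ 'n \<Rightarrow> complex) \<Rightarrow> (real ^ 'n \<Rightarrow> complex) \<Rightarrow>
   (real ^ 'n \<Rightarrow> complex) \<Rightarrow> (real ^ 'n \<Rightarrow> complex) \<Rightarrow> bool" where
  "iteration_step \<Omega> D k \<epsilon> f g u_old u_new \<longleftrightarrow>
     helm_solves \<Omega> D k \<epsilon> 2 u_old
       (\<lambda>v s. - complex_of_real (k\<^sup>2 * \<epsilon>) *
                 L2_ip (lebesgue_on D) (\<lambda>x. complex_of_real ((cmod (u_old x))\<^sup>2) * u_old x) v
              + data_rhs \<Omega> f g v s)
       u_new"

definition iteration ::
  "(real ^ 'n::finite) set \<Rightarrow> (real ^ 'n) set \<Rightarrow> real \<Rightarrow> real \<Rightarrow>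
   (real ^ 'n \<Rightarrow> complex) \<Rightarrow> (real ^ 'n \<Rightarrow> complex) \<Rightarrow> (nat \<Rightarrow> real ^ 'n \<Rightarrow> complex) \<Rightarrow> bool" where
  "iteration \<Omega> D k \<epsilon> f g U \<longleftrightarrow>
     U 0 = (\<lambda>_. 0) \<and> (\<forall>l\<ge>1. iteration_step \<Omega> D k \<epsilon> f g (U (l - 1)) (U l))"


section \<open>Known stability results\<close>

definition linearized_stability ::
  "(real ^ 'n::finite) set \<Rightarrow> (real ^ 'n) set \<Rightarrow> real \<Rightarrow> real \<Rightarrow> real \<Rightarrow> real \<Rightarrow> real \<Rightarrow> bool" where
  "linearized_stability \<Omega> D k0 \<theta>1 C1 C2 Cinf \<longleftrightarrow>
     (\<forall>k\<ge>k0. \<forall>\<epsilon>>0. \<forall>\<Phi> \<in> H1 \<Omega> \<inter> Linf (lebesgue_on D).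
        k * \<epsilon> * (Linf_norm (lebesgue_on D) \<Phi>)\<^sup>2 \<le> \<theta>1 \<longrightarrow>
        (\<forall>f \<in> L2 (lebesgue_on \<Omega>). \<forall>g \<in> Hhalf \<Omega>. \<exists>w.
           linearized_solution \<Omega> D k \<epsilon> \<Phi> f g w \<and>
           (\<forall>w'. linearized_solution \<Omega> D k \<epsilon> \<Phi> f g w' \<longrightarrow> (AE x in lebesgue_on \<Omega>. w' x = w x)) \<and>
           H1k_norm \<Omega> k w \<le> C1 * C_data \<Omega> f g \<and>
           w \<in> H2 \<Omega> \<and> H2_norm \<Omega> w \<le> C2 * k * C_data \<Omega> f g \<and>
           w \<in> Linf (lebesgue_on D) \<and>
           Linf_norm (lebesgue_on D) w \<le> Cinf * k powr ((real CARD('n) - 3) / 2) * C_data \<Omega> f g))"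

text \<open>\<open>C\<close> is a common constant for the three a priori bounds, independent of \<open>k\<close>.\<close>

definition nonlinear_well_posed ::
  "(real ^ 'n::finite) set \<Rightarrow> (real ^ 'n) set \<Rightarrow> real \<Rightarrow> real \<Rightarrow> real \<Rightarrow> bool" where
  "nonlinear_well_posed \<Omega> D k0 \<theta>0 C \<longleftrightarrow>
     (\<forall>k\<ge>k0. \<forall>\<epsilon>>0. \<forall>f \<in> L2 (lebesgue_on \<Omega>). \<forall>g \<in> Hhalf \<Omega>.
        k ^ (CARD('n) - 2) * \<epsilon> * (C_data \<Omega> f g)\<^sup>2 < \<theta>0 \<longrightarrow>
        (\<exists>u. nonlinear_solution \<Omega> D k \<epsilon> f g u \<and>
           (\<forall>u'. nonlinear_solution \<Omega> D k \<epsilon> f g u' \<longrightarrow> (AE x in lebesgue_on \<Omega>. u' x = u x)) \<and>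
           H1k_norm \<Omega> k u \<le> C * C_data \<Omega> f g \<and>
           u \<in> H2 \<Omega> \<and> H2_norm \<Omega> u \<le> C * k * C_data \<Omega> f g \<and>
           u \<in> Linf (lebesgue_on D) \<and>
           Linf_norm (lebesgue_on D) u \<le> C * k powr ((real CARD('n) - 3) / 2) * C_data \<Omega> f g))"


section \<open>Linear convergence\<close>

definition converges_linearly ::
  "(('a \<Rightarrow> complex) \<Rightarrow> real) \<Rightarrow> (nat \<Rightarrow> 'a \<Rightarrow> complex) \<Rightarrow> ('a \<Rightarrow> complex) \<Rightarrow> bool" where
  "converges_linearly N U u \<longleftrightarrow>
     (\<lambda>l. N (\<lambda>x. U l x - u x)) \<longlonglongrightarrow> 0 \<and>
     (\<exists>\<rho>. 0 \<le> \<rho> \<and> \<rho> < 1 \<and> (\<forall>l. N (\<lambda>x. U (Suc l) x - u x) \<le> \<rho> * N (\<lambda>x. U l x - u x)))"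

end

(* An iteration step is a linearized problem with 2 epsilon in place of epsilon and the source
   f - k^2 epsilon chi_D |a|^2 a.  The smallness condition keeps all iterates in a set where the
   L^infinity(D) norm is at most B and the sources stay bounded, so the linear stability estimate
   applies to every step.  The difference of two consecutive iterates (or of an iterate and a
   fixed point) again solves such a linear problem, with zero boundary data and a source bounded
   pointwise by 3 k^2 epsilon B^2 times the previous difference, which gives the contraction
   factor 3 q < 1/2.  The limit h exists because H^1 is complete; w obtained from h by one more
   step is the limit of the iterates as well, so w = h and w solves the nonlinear problem. *)

theory Submission
  imports Defs "HOL-Computational_Algebra.Polynomial"
begin

section \<open>Square-integrable functions\<close>

text \<open>Functions are representatives and \<open>wgrad\<close> is a choice among weak gradients.
  Subtracting two problems therefore rests on uniqueness of weak gradients up to null sets, which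
  needs a supply of test functions; this is why explicit bumps are built. The constants come from E
  = \<open>C_data \<Omega> f g\<close>. If the data of one step are at most x, its result
  contributes at most q x to the cubic source of the next, whose data are then at most E + q x. The
  fixed point x = E / (1 - q) determines B, and the factor (1 - q)^2 in the smallness condition
  cancels the denominator of B^2. The bound q < C1 \<theta>1 / 2 pays for the doubled \<epsilon>,
  the bound q < 1/6 for the factor 3 q. The factor 3 depends on a coincidence: the result of one of
  the two compared steps is also the starting point of one of them. Two unrelated steps only give 7
  q, which can exceed 1. That weaker bound serves for the passage to the limit, where continuity of
  a step suffices.\<close>

lemma L2_measurable: "f \<in> L2 M \<Longrightarrow> f \<in> borel_measurable M"
  by (simp add: L2_def)

lemma L2_integrable: "f \<in> L2 M \<Longrightarrow> integrable M (\<lambda>x. (norm (f x))\<^sup>2)"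
  by (simp add: L2_def)

lemma L2_norm_nonneg: "0 \<le> L2_norm M f"
  by (simp add: L2_norm_def)

lemma L2_norm_sq: "(L2_norm M f)\<^sup>2 = (LINT x|M. (norm (f x))\<^sup>2)"
  by (simp add: L2_norm_def)

lemma L2_bounded:
  fixes f :: "'a \<Rightarrow> 'b::euclidean_space" and g :: "'a \<Rightarrow> 'c::euclidean_space"
  assumes g: "g \<in> L2 M" and f: "f \<in> borel_measurable M"
    and le: "AE x in M. norm (f x) \<le> C * norm (g x)" and C: "0 \<le> C"
  shows "f \<in> L2 M" and "L2_norm M f \<le> C * L2_norm M g"
proof -
  note [measurable] = f
  have int: "integrable M (\<lambda>x. C\<^sup>2 * (norm (g x))\<^sup>2)"
    using L2_integrable[OF g] by simp
  have le2: "AE x in M. (norm (f x))\<^sup>2 \<le> C\<^sup>2 * (norm (g x))\<^sup>2"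
    using le
  proof eventually_elim
    case (elim x)
    then have "(norm (f x))\<^sup>2 \<le> (C * norm (g x))\<^sup>2" by (intro power_mono) auto
    then show ?case by (simp add: power_mult_distrib)
  qed
  have int_f: "integrable M (\<lambda>x. (norm (f x))\<^sup>2)"
  proof (rule Bochner_Integration.integrable_bound[OF int])
    show "(\<lambda>x. (norm (f x))\<^sup>2) \<in> borel_measurable M" by measurable
    show "AE x in M. norm ((norm (f x))\<^sup>2) \<le> norm (C\<^sup>2 * (norm (g x))\<^sup>2)"
      using le2 by eventually_elim simp
  qed
  then show "f \<in> L2 M" using f by (simp add: L2_def)
  have "(L2_norm M f)\<^sup>2 \<le> (C * L2_norm M g)\<^sup>2"
    using integral_mono_AE[OF int_f int le2]
    by (simp add: L2_norm_sq power_mult_distrib)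
  then show "L2_norm M f \<le> C * L2_norm M g"
    by (rule power2_le_imp_le) (simp add: C L2_norm_nonneg)
qed

lemma L2_zero: "(\<lambda>x. 0) \<in> L2 M"
  by (simp add: L2_def)

lemma L2_norm_zero [simp]: "L2_norm M (\<lambda>x. 0) = 0"
  by (simp add: L2_norm_def)

lemma L2_add:
  fixes f g :: "'a \<Rightarrow> 'b::euclidean_space"
  assumes f: "f \<in> L2 M" and g: "g \<in> L2 M"
  shows "(\<lambda>x. f x + g x) \<in> L2 M"
proof -
  note [measurable] = L2_measurable[OF f] L2_measurable[OF g]
  have "integrable M (\<lambda>x. (norm (f x + g x))\<^sup>2)"
  proof (rule Bochner_Integration.integrable_bound)
    show "integrable M (\<lambda>x. 2 * (norm (f x))\<^sup>2 + 2 * (norm (g x))\<^sup>2)"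
      using L2_integrable[OF f] L2_integrable[OF g] by simp
    show "(\<lambda>x. (norm (f x + g x))\<^sup>2) \<in> borel_measurable M" by measurable
    show "AE x in M. norm ((norm (f x + g x))\<^sup>2) \<le> norm (2 * (norm (f x))\<^sup>2 + 2 * (norm (g x))\<^sup>2)"
    proof (rule AE_I2)
      fix x
      have "(norm (f x + g x))\<^sup>2 \<le> (norm (f x) + norm (g x))\<^sup>2"
        by (intro power_mono norm_triangle_ineq) auto
      also have "\<dots> \<le> 2 * (norm (f x))\<^sup>2 + 2 * (norm (g x))\<^sup>2"
        using sum_squares_bound[of "norm (f x)" "norm (g x)"] by (simp add: power2_sum)
      finally show "norm ((norm (f x + g x))\<^sup>2) \<le> norm (2 * (norm (f x))\<^sup>2 + 2 * (norm (g x))\<^sup>2)"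
        by simp
    qed
  qed
  then show ?thesis by (simp add: L2_def)
qed

lemma L2_minus:
  "f \<in> L2 M \<Longrightarrow> (\<lambda>x. - f x :: 'b::euclidean_space) \<in> L2 M"
  by (simp add: L2_def)

lemma L2_diff:
  fixes f g :: "'a \<Rightarrow> 'b::euclidean_space"
  assumes "f \<in> L2 M" "g \<in> L2 M"
  shows "(\<lambda>x. f x - g x) \<in> L2 M"
  using L2_add[OF assms(1) L2_minus[OF assms(2)]] by simp

lemma L2_cmult:
  fixes f :: "'a \<Rightarrow> complex"
  assumes "f \<in> L2 M" shows "(\<lambda>x. c * f x) \<in> L2 M"
proof -
  have [measurable]: "f \<in> borel_measurable M" by (rule L2_measurable[OF assms])
  show ?thesis
    by (rule L2_bounded(1)[OF assms, of _ "cmod c"]) (auto simp: norm_mult)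
qed

lemma L2_norm_cong_AE:
  fixes f g :: "'a \<Rightarrow> 'b::euclidean_space"
  assumes [measurable]: "f \<in> borel_measurable M" "g \<in> borel_measurable M"
    and "AE x in M. f x = g x"
  shows "L2_norm M f = L2_norm M g"
proof -
  have "(LINT x|M. (norm (f x))\<^sup>2) = (LINT x|M. (norm (g x))\<^sup>2)"
    using assms(3) by (intro integral_cong_AE) (auto elim: eventually_mono)
  then show ?thesis by (simp add: L2_norm_def)
qed

lemma L2_norm_eq_0_AE:
  fixes f :: "'a \<Rightarrow> 'b::euclidean_space"
  assumes "f \<in> L2 M" "L2_norm M f = 0"
  shows "AE x in M. f x = 0"
proof -
  have "(LINT x|M. (norm (f x))\<^sup>2) = 0" using assms(2) by (simp add: L2_norm_def)
  then have "AE x in M. (norm (f x))\<^sup>2 = 0"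
    by (subst (asm) integral_nonneg_eq_0_iff_AE[OF L2_integrable[OF assms(1)]]) auto
  then show ?thesis by simp
qed

lemma L2_mult_integrable:
  fixes f :: "'a \<Rightarrow> 'b::euclidean_space" and g :: "'a \<Rightarrow> 'c::euclidean_space"
  assumes f: "f \<in> L2 M" and g: "g \<in> L2 M"
  shows "integrable M (\<lambda>x. norm (f x) * norm (g x))"
proof (rule Bochner_Integration.integrable_bound)
  note [measurable] = L2_measurable[OF f] L2_measurable[OF g]
  show "integrable M (\<lambda>x. (norm (f x))\<^sup>2 + (norm (g x))\<^sup>2)"
    using L2_integrable[OF f] L2_integrable[OF g] by simp
  show "(\<lambda>x. norm (f x) * norm (g x)) \<in> borel_measurable M" by measurable
  show "AE x in M. norm (norm (f x) * norm (g x)) \<le> norm ((norm (f x))\<^sup>2 + (norm (g x))\<^sup>2)"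
  proof (rule AE_I2)
    fix x
    have "2 * (norm (f x) * norm (g x)) \<le> (norm (f x))\<^sup>2 + (norm (g x))\<^sup>2"
      using sum_squares_bound[of "norm (f x)" "norm (g x)"] by simp
    moreover have "0 \<le> norm (f x) * norm (g x)" by simp
    ultimately show "norm (norm (f x) * norm (g x)) \<le> norm ((norm (f x))\<^sup>2 + (norm (g x))\<^sup>2)"
      unfolding real_norm_def by linarith
  qed
qed

lemma L2_Cauchy_Schwarz:
  fixes f :: "'a \<Rightarrow> 'b::euclidean_space" and g :: "'a \<Rightarrow> 'c::euclidean_space"
  assumes f: "f \<in> L2 M" and g: "g \<in> L2 M"
  shows "(LINT x|M. norm (f x) * norm (g x)) \<le> L2_norm M f * L2_norm M g"
proof -
  note [measurable] = L2_measurable[OF f] L2_measurable[OF g]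
  let ?a = "L2_norm M f" and ?b = "L2_norm M g"
  show ?thesis
  proof (cases "?a = 0 \<or> ?b = 0")
    case True
    then have "AE x in M. norm (f x) * norm (g x) = 0"
      using L2_norm_eq_0_AE[OF f] L2_norm_eq_0_AE[OF g] by (auto elim: eventually_mono)
    then have "(LINT x|M. norm (f x) * norm (g x)) = (LINT x|M. 0)"
      by (intro integral_cong_AE) auto
    then show ?thesis by (simp add: L2_norm_nonneg)
  next
    case False
    then have pos: "0 < ?a" "0 < ?b"
      using L2_norm_nonneg[of M f] L2_norm_nonneg[of M g] by linarith+
    \<comment> \<open>Young's inequality with weights chosen so that after integration both terms on
      the right equal \<open>?a * ?b\<close>.\<close>
    have "2 * (norm (f x) * norm (g x)) \<le> ?b / ?a * (norm (f x))\<^sup>2 + ?a / ?b * (norm (g x))\<^sup>2" for x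
    proof -
      have "2 * (?b * norm (f x)) * (?a * norm (g x)) \<le> (?b * norm (f x))\<^sup>2 + (?a * norm (g x))\<^sup>2"
        by (rule sum_squares_bound)
      then have "2 * (norm (f x) * norm (g x)) \<le> ((?b * norm (f x))\<^sup>2 + (?a * norm (g x))\<^sup>2) / (?a * ?b)"
        using pos by (subst pos_le_divide_eq) (auto simp: ac_simps)
      also have "\<dots> = ?b / ?a * (norm (f x))\<^sup>2 + ?a / ?b * (norm (g x))\<^sup>2"
        using pos by (simp add: add_divide_distrib power2_eq_square ac_simps)
      finally show ?thesis .
    qed
    then have "(LINT x|M. 2 * (norm (f x) * norm (g x)))
        \<le> (LINT x|M. ?b / ?a * (norm (f x))\<^sup>2 + ?a / ?b * (norm (g x))\<^sup>2)"
      using L2_mult_integrable[OF f g] L2_integrable[OF f] L2_integrable[OF g]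
      by (intro integral_mono) auto
    also have "\<dots> = ?b / ?a * ?a\<^sup>2 + ?a / ?b * ?b\<^sup>2"
      unfolding L2_norm_sq using L2_integrable[OF f] L2_integrable[OF g] by simp
    also have "\<dots> = 2 * (?a * ?b)" using pos by (simp add: power2_eq_square)
    finally show ?thesis by simp
  qed
qed

lemma L2_norm_triangle:
  fixes f g :: "'a \<Rightarrow> 'b::euclidean_space"
  assumes f: "f \<in> L2 M" and g: "g \<in> L2 M"
  shows "L2_norm M (\<lambda>x. f x + g x) \<le> L2_norm M f + L2_norm M g"
proof (rule power2_le_imp_le)
  have "(L2_norm M (\<lambda>x. f x + g x))\<^sup>2
      \<le> (LINT x|M. (norm (f x))\<^sup>2 + 2 * (norm (f x) * norm (g x)) + (norm (g x))\<^sup>2)"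
    unfolding L2_norm_sq
  proof (rule integral_mono)
    show "integrable M (\<lambda>x. (norm (f x + g x))\<^sup>2)" by (rule L2_integrable[OF L2_add[OF f g]])
    show "integrable M (\<lambda>x. (norm (f x))\<^sup>2 + 2 * (norm (f x) * norm (g x)) + (norm (g x))\<^sup>2)"
      using L2_mult_integrable[OF f g] L2_integrable[OF f] L2_integrable[OF g] by simp
    fix x
    have "(norm (f x + g x))\<^sup>2 \<le> (norm (f x) + norm (g x))\<^sup>2"
      by (intro power_mono norm_triangle_ineq) auto
    then show "(norm (f x + g x))\<^sup>2 \<le> (norm (f x))\<^sup>2 + 2 * (norm (f x) * norm (g x)) + (norm (g x))\<^sup>2"
      by (simp add: power2_sum)
  qed
  also have "\<dots> = (L2_norm M f)\<^sup>2 + 2 * (LINT x|M. norm (f x) * norm (g x)) + (L2_norm M g)\<^sup>2"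
    using L2_mult_integrable[OF f g] L2_integrable[OF f] L2_integrable[OF g]
    by (simp add: L2_norm_sq)
  also have "\<dots> \<le> (L2_norm M f + L2_norm M g)\<^sup>2"
    using L2_Cauchy_Schwarz[OF f g] by (simp add: power2_sum)
  finally show "(L2_norm M (\<lambda>x. f x + g x))\<^sup>2 \<le> (L2_norm M f + L2_norm M g)\<^sup>2" .
qed (simp add: L2_norm_nonneg)

lemma L2_norm_minus [simp]: "L2_norm M (\<lambda>x. - f x :: 'b::euclidean_space) = L2_norm M f"
  by (simp add: L2_norm_def)

lemma L2_norm_minus_commute:
  "L2_norm M (\<lambda>x. f x - g x :: 'b::euclidean_space) = L2_norm M (\<lambda>x. g x - f x)"
  by (simp add: L2_norm_def norm_minus_commute)

lemma L2_norm_diff_triangle: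
  fixes f g :: "'a \<Rightarrow> 'b::euclidean_space"
  assumes f: "f \<in> L2 M" and g: "g \<in> L2 M"
  shows "L2_norm M (\<lambda>x. f x - g x) \<le> L2_norm M f + L2_norm M g"
  using L2_norm_triangle[OF f L2_minus[OF g]] by simp

lemma L2_ip_integrable:
  assumes f: "f \<in> L2 M" and g: "g \<in> L2 M"
  shows "integrable M (\<lambda>x. f x * cnj (g x))"
proof -
  note [measurable] = L2_measurable[OF f] L2_measurable[OF g]
  have [measurable]: "(\<lambda>x. cnj (g x)) \<in> borel_measurable M"
    using borel_measurable_continuous_onI[OF continuous_on_cnj[OF continuous_on_id]]
      measurable_compose[OF L2_measurable[OF g]] by blast
  show ?thesis
    by (rule Bochner_Integration.integrable_bound[OF L2_mult_integrable[OF f g]])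
       (auto simp: norm_mult)
qed

lemma L2_ip_add_left:
  assumes "f \<in> L2 M" "g \<in> L2 M" "h \<in> L2 M"
  shows "L2_ip M (\<lambda>x. f x + g x) h = L2_ip M f h + L2_ip M g h"
  using L2_ip_integrable[OF assms(1,3)] L2_ip_integrable[OF assms(2,3)]
  by (simp add: L2_ip_def distrib_right)

lemma L2_ip_diff_left:
  assumes "f \<in> L2 M" "g \<in> L2 M" "h \<in> L2 M"
  shows "L2_ip M (\<lambda>x. f x - g x) h = L2_ip M f h - L2_ip M g h"
  using L2_ip_integrable[OF assms(1,3)] L2_ip_integrable[OF assms(2,3)]
  by (simp add: L2_ip_def left_diff_distrib)

lemma L2_ip_cmult_left: "L2_ip M (\<lambda>x. c * f x) h = c * L2_ip M f h"
  by (simp add: L2_ip_def mult.assoc)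

lemma L2_ip_cong_AE_left:
  assumes f: "f \<in> borel_measurable M" and g: "g \<in> borel_measurable M"
    and h: "h \<in> borel_measurable M" and eq: "AE x in M. f x = g x"
  shows "L2_ip M f h = L2_ip M g h"
proof -
  note [measurable] = f g
  have [measurable]: "(\<lambda>x. cnj (h x)) \<in> borel_measurable M"
    using borel_measurable_continuous_onI[OF continuous_on_cnj[OF continuous_on_id]]
      measurable_compose[OF h] by blast
  show ?thesis
    unfolding L2_ip_def using eq by (intro integral_cong_AE) (auto elim: eventually_mono)
qed

section \<open>Completeness of L^2 along geometrically decaying increments\<close>

lemma L2_telescope:
  fixes f :: "nat \<Rightarrow> 'a \<Rightarrow> 'b::euclidean_space"
  assumes f: "\<And>n. f n \<in> L2 M"
    and geo: "\<And>n. L2_norm M (\<lambda>x. f (Suc n) x - f n x) \<le> K * (1/2) ^ n"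
  shows "L2_norm M (\<lambda>x. f (n + m) x - f n x) \<le> 2 * K * (1/2) ^ n - 2 * K * (1/2) ^ (n + m)"
proof (induction m)
  case 0
  then show ?case by simp
next
  case (Suc m)
  have "L2_norm M (\<lambda>x. f (n + Suc m) x - f n x)
      = L2_norm M (\<lambda>x. (f (Suc (n + m)) x - f (n + m) x) + (f (n + m) x - f n x))"
    by simp
  also have "\<dots> \<le> L2_norm M (\<lambda>x. f (Suc (n + m)) x - f (n + m) x)
      + L2_norm M (\<lambda>x. f (n + m) x - f n x)"
    by (intro L2_norm_triangle L2_diff f)
  also have "\<dots> \<le> K * (1/2) ^ (n + m) + (2 * K * (1/2) ^ n - 2 * K * (1/2) ^ (n + m))"
    using geo[of "n + m"] Suc by (rule add_mono)
  \<comment> \<open>The subtracted term, twice the next increment bound, is what closes the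
    induction: K r - 2 K r = - 2 K (r / 2).\<close>
  also have "\<dots> = 2 * K * (1/2) ^ n - 2 * K * (1/2) ^ (n + Suc m)"
    by simp
  finally show ?case .
qed

text \<open>Geometric decay makes the whole sequence converge almost everywhere, not merely a
  subsequence as for general L^2 convergence. The pointwise limit is needed later to carry the bound
  on D over to the limit of the iterates.\<close>

lemma L2_geometric_limit:
  fixes f :: "nat \<Rightarrow> 'a \<Rightarrow> 'b::euclidean_space"
  assumes f: "\<And>n. f n \<in> L2 M"
    and geo: "\<And>n. L2_norm M (\<lambda>x. f (Suc n) x - f n x) \<le> K * (1/2) ^ n"
  obtains h where "h \<in> L2 M" "AE x in M. (\<lambda>n. f n x) \<longlonglongrightarrow> h x"
    "\<And>n. L2_norm M (\<lambda>x. f n x - h x) \<le> 2 * K * (1/2) ^ n"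
proof -
  have [measurable]: "f n \<in> borel_measurable M" for n by (rule L2_measurable[OF f])
  have K: "0 \<le> K" using order_trans[OF L2_norm_nonneg geo[of 0]] by simp
  define e where "e n x = f (Suc n) x - f n x" for n x
  have e: "e n \<in> L2 M" for n unfolding e_def by (intro L2_diff f)
  have [measurable]: "e n \<in> borel_measurable M" for n by (rule L2_measurable[OF e])
  text \<open>The weights \<open>2\<^sup>n\<close> make the squared norms of the increments summable and at the same time
    force the increments to decay geometrically almost everywhere.\<close>
  have "(\<integral>\<^sup>+x. ennreal (2 ^ n * (norm (e n x))\<^sup>2) \<partial>M) \<le> ennreal (K\<^sup>2 * (1/2) ^ n)" for n
  proof -
    have "(\<integral>\<^sup>+x. ennreal (2 ^ n * (norm (e n x))\<^sup>2) \<partial>M) = ennreal (2 ^ n * (L2_norm M (e n))\<^sup>2)"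
      unfolding L2_norm_sq using L2_integrable[OF e[of n]]
      by (subst nn_integral_eq_integral) auto
    also have "(L2_norm M (e n))\<^sup>2 \<le> (K * (1/2) ^ n)\<^sup>2"
      using geo[of n] by (intro power_mono L2_norm_nonneg) (simp add: e_def[abs_def])
    then have "2 ^ n * (L2_norm M (e n))\<^sup>2 \<le> 2 ^ n * (K * (1/2) ^ n)\<^sup>2" by simp
    also have "2 ^ n * (K * (1/2) ^ n)\<^sup>2 = K\<^sup>2 * (1/2) ^ n"
      by (simp add: power_mult_distrib power_divide field_simps flip: power_mult power_add)
    finally show ?thesis by (simp add: ennreal_leI)
  qed
  then have "(\<integral>\<^sup>+x. (\<Sum>n. ennreal (2 ^ n * (norm (e n x))\<^sup>2)) \<partial>M) \<le> (\<Sum>n. ennreal (K\<^sup>2 * (1/2) ^ n))"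
    by (subst nn_integral_suminf) (auto intro!: suminf_le)
  also have "\<dots> < \<infinity>"
    by (subst suminf_ennreal2) (auto intro!: summable_mult summable_geometric)
  finally have "AE x in M. (\<Sum>n. ennreal (2 ^ n * (norm (e n x))\<^sup>2)) \<noteq> \<infinity>"
    by (intro nn_integral_PInf_AE) auto
  then have conv: "AE x in M. convergent (\<lambda>n. f n x)"
  proof eventually_elim
    case (elim x)
    then have "summable (\<lambda>n. 2 ^ n * (norm (e n x))\<^sup>2)"
      by (intro summable_suminf_not_top) auto
    then have "Bseq (\<lambda>n. 2 ^ n * (norm (e n x))\<^sup>2)"
      using summable_LIMSEQ_zero convergentI convergent_imp_Bseq by blast
    then obtain B where B: "0 < B" "\<And>n. 2 ^ n * (norm (e n x))\<^sup>2 \<le> B"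
      unfolding Bseq_def by auto
    \<comment> \<open>Boundedness of the weighted squares costs a square root: the increments decay
      with ratio \<open>sqrt (1/2)\<close>, still below 1.\<close>
    have "norm (e n x) \<le> sqrt B * (sqrt (1/2)) ^ n" for n
    proof (rule power2_le_imp_le)
      show "(norm (e n x))\<^sup>2 \<le> (sqrt B * (sqrt (1/2)) ^ n)\<^sup>2"
        using B(1) B(2)[of n]
        by (simp add: power_mult_distrib field_simps power_even_eq real_sqrt_power[symmetric] power_divide real_sqrt_divide)
    qed (use B(1) in simp)
    moreover have "summable (\<lambda>n. sqrt B * (sqrt (1/2)) ^ n)"
      by (intro summable_mult summable_geometric) simp
    ultimately have "summable (\<lambda>n. e n x)"
      by (intro summable_comparison_test'[where N = 0 and f = "\<lambda>n. e n x"])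
    then have "convergent (\<lambda>n. \<Sum>i<n. e i x)"
      by (simp add: summable_iff_convergent)
    moreover have "(\<Sum>i<n. e i x) = f n x - f 0 x" for n
      unfolding e_def by (rule sum_lessThan_telescope)
    ultimately have "convergent (\<lambda>n. (f n x - f 0 x) + f 0 x)"
      using convergent_add_const_right_iff[of "\<lambda>n. f n x - f 0 x" "f 0 x"] by simp
    then show ?case by simp
  qed
  define h where "h x = lim (\<lambda>n. f n x)" for x
  have [measurable]: "h \<in> borel_measurable M"
    unfolding h_def by (rule borel_measurable_lim_metric) measurable
  have lim: "AE x in M. (\<lambda>n. f n x) \<longlonglongrightarrow> h x"
    using conv by eventually_elim (simp add: h_def convergent_LIMSEQ_iff)
  \<comment> \<open>Fatou's lemma in m: the distance to h is the liminf of the distances to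
    \<open>f (n + m)\<close>, which \<open>L2_telescope\<close> bounds uniformly in m.\<close>
  have tail: "(\<integral>\<^sup>+x. ennreal ((norm (f n x - h x))\<^sup>2) \<partial>M) \<le> ennreal ((2 * K * (1/2) ^ n)\<^sup>2)" for n
  proof -
    have "(\<integral>\<^sup>+x. ennreal ((norm (f n x - h x))\<^sup>2) \<partial>M)
        = (\<integral>\<^sup>+x. liminf (\<lambda>m. ennreal ((norm (f n x - f (n + m) x))\<^sup>2)) \<partial>M)"
    proof (rule nn_integral_cong_AE)
      show "AE x in M. ennreal ((norm (f n x - h x))\<^sup>2)
          = liminf (\<lambda>m. ennreal ((norm (f n x - f (n + m) x))\<^sup>2))"
        using lim
      proof eventually_elim
        case (elim x)
        have "(\<lambda>m. ennreal ((norm (f n x - f (n + m) x))\<^sup>2)) \<longlonglongrightarrow> ennreal ((norm (f n x - h x))\<^sup>2)"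
          using LIMSEQ_ignore_initial_segment[OF elim, of n]
          by (intro tendsto_intros) (simp add: add.commute)
        then show ?case by (intro lim_imp_Liminf[symmetric]) auto
      qed
    qed
    also have "\<dots> \<le> liminf (\<lambda>m. \<integral>\<^sup>+x. ennreal ((norm (f n x - f (n + m) x))\<^sup>2) \<partial>M)"
      by (rule nn_integral_liminf) measurable
    also have "\<dots> \<le> ennreal ((2 * K * (1/2) ^ n)\<^sup>2)"
    proof (rule Liminf_le[OF sequentially_bot always_eventually, rule_format])
      fix m
      have "(\<integral>\<^sup>+x. ennreal ((norm (f n x - f (n + m) x))\<^sup>2) \<partial>M)
          = ennreal ((L2_norm M (\<lambda>x. f n x - f (n + m) x))\<^sup>2)"
        unfolding L2_norm_sq
        by (intro nn_integral_eq_integral L2_integrable L2_diff f) auto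
      also have "\<dots> \<le> ennreal ((2 * K * (1/2) ^ n)\<^sup>2)"
      proof (intro ennreal_leI power_mono L2_norm_nonneg)
        have "0 \<le> 2 * K * (1/2) ^ (n + m)" using K by simp
        then show "L2_norm M (\<lambda>x. f n x - f (n + m) x) \<le> 2 * K * (1/2) ^ n"
          using L2_telescope[of f M K n m, OF f geo] L2_norm_minus_commute[of M "f n" "f (n + m)"]
          by linarith
      qed
      finally show "(\<integral>\<^sup>+x. ennreal ((norm (f n x - f (n + m) x))\<^sup>2) \<partial>M)
          \<le> ennreal ((2 * K * (1/2) ^ n)\<^sup>2)" .
    qed
    finally show ?thesis .
  qed
  have diff: "(\<lambda>x. f n x - h x) \<in> L2 M" for n
  proof -
    have "integrable M (\<lambda>x. (norm (f n x - h x))\<^sup>2)"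
      using le_less_trans[OF tail[of n] ennreal_less_top] by (intro integrableI_bounded) auto
    then show ?thesis by (simp add: L2_def)
  qed
  have "h \<in> L2 M"
    using L2_diff[OF f[of 0] diff[of 0]] by simp
  moreover have "L2_norm M (\<lambda>x. f n x - h x) \<le> 2 * K * (1/2) ^ n" for n
  proof (rule power2_le_imp_le)
    have "ennreal ((L2_norm M (\<lambda>x. f n x - h x))\<^sup>2) \<le> ennreal ((2 * K * (1/2) ^ n)\<^sup>2)"
      using tail[of n] unfolding L2_norm_sq
      by (subst nn_integral_eq_integral[symmetric]) (auto intro: L2_integrable diff)
    then show "(L2_norm M (\<lambda>x. f n x - h x))\<^sup>2 \<le> (2 * K * (1/2) ^ n)\<^sup>2" by simp
  qed (use K in simp)
  ultimately show ?thesis using lim by (intro that)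
qed

section \<open>Test functions and uniqueness of weak gradients\<close>

text \<open>The classical flat function exp(-1/s), extended by 0 to s \<le> 0. The polynomial factor
  in 1/s makes the family closed under differentiation.\<close>

definition exp_cutoff :: "real poly \<Rightarrow> real \<Rightarrow> real" where
  "exp_cutoff p s = (if s > 0 then poly p (1 / s) * exp (- (1 / s)) else 0)"

text \<open>With y = 1/s, the derivative of p(y) exp(-y) is (p'(y) - p(y)) exp(-y) times dy/ds = -
  y^2; the factor \<open>[:0, 0, 1:]\<close> is y^2.\<close>

definition exp_cutoff_deriv :: "real poly \<Rightarrow> real poly" where
  "exp_cutoff_deriv p = (p - pderiv p) * [:0, 0, 1:]"

lemma poly_exp_minus_tendsto_0: "((\<lambda>y::real. poly q y * exp (- y)) \<longlongrightarrow> 0) at_top"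
proof -
  have "((\<lambda>y. \<Sum>i\<le>degree q. coeff q i * (y ^ i / exp y)) \<longlongrightarrow> (\<Sum>i\<le>degree q. coeff q i * 0)) at_top"
    by (intro tendsto_sum tendsto_mult tendsto_const tendsto_power_div_exp_0)
  moreover have "(\<Sum>i\<le>degree q. coeff q i * (y ^ i / exp y)) = poly q y * exp (- y)" for y
    by (simp add: poly_altdef sum_distrib_right sum_distrib_left exp_minus divide_inverse mult.assoc)
  ultimately show ?thesis by simp
qed

lemma exp_cutoff_has_derivative:
  "(exp_cutoff p has_real_derivative exp_cutoff (exp_cutoff_deriv p) s) (at s)"
proof -
  consider "s > 0" | "s < 0" | "s = 0" by linarith
  then show ?thesis
  proof cases
    case 1
    have "((\<lambda>s. poly p (1 / s) * exp (- (1 / s))) has_real_derivative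
        exp_cutoff (exp_cutoff_deriv p) s) (at s)"
      using 1 by (auto intro!: derivative_eq_intros DERIV_chain2[OF poly_DERIV]
        simp: exp_cutoff_def exp_cutoff_deriv_def field_simps power2_eq_square)
    then show ?thesis
      by (rule has_field_derivative_transform_within_open[where S = "{0<..}"])
        (use 1 in \<open>auto simp: exp_cutoff_def\<close>)
  next
    case 2
    have "((\<lambda>s. 0) has_real_derivative exp_cutoff (exp_cutoff_deriv p) s) (at s)"
      using 2 by (simp add: exp_cutoff_def)
    then show ?thesis
      by (rule has_field_derivative_transform_within_open[where S = "{..<0}"])
        (use 2 in \<open>auto simp: exp_cutoff_def\<close>)
  next
    case 3
    \<comment> \<open>At the origin the difference quotient from the right is again a polynomial in
      1/h times exp(-1/h): \<open>pCons 0 p\<close> is p multiplied by its variable.\<close>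
    have "((\<lambda>h. exp_cutoff p h / h) \<longlongrightarrow> 0) (at_right 0)"
    proof (rule tendsto_cong[THEN iffD1])
      show "((\<lambda>h. poly (pCons 0 p) (inverse h) * exp (- inverse h)) \<longlongrightarrow> 0) (at_right 0)"
        by (rule filterlim_compose[OF poly_exp_minus_tendsto_0 filterlim_inverse_at_top_right])
      show "\<forall>\<^sub>F h in at_right 0.
          poly (pCons 0 p) (inverse h) * exp (- inverse h) = exp_cutoff p h / h"
        unfolding eventually_at_right_field
        by (intro exI[of _ 1]) (auto simp: exp_cutoff_def field_simps)
    qed
    moreover have "((\<lambda>h. exp_cutoff p h / h) \<longlongrightarrow> 0) (at_left 0)"
    proof (rule tendsto_cong[THEN iffD1, OF _ tendsto_const])
      show "\<forall>\<^sub>F h in at_left 0. 0 = exp_cutoff p h / h"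
        unfolding eventually_at_left_field
        by (intro exI[of _ "-1"]) (auto simp: exp_cutoff_def)
    qed
    ultimately have "((\<lambda>h. exp_cutoff p h / h) \<longlongrightarrow> 0) (at 0)"
      by (simp add: filterlim_at_split)
    then show ?thesis using 3 by (simp add: DERIV_def exp_cutoff_def)
  qed
qed

text \<open>An algebra closed under all \<open>partial j\<close>, so that smoothness follows by
  induction on the list of derivatives and no formula for higher derivatives is needed. The
  generators take an affine argument so that the boundary of a box can be approached from either
  side.\<close>

inductive_set bump_algebra :: "(real ^ 'n::finite \<Rightarrow> real) set" where
  cutoff: "(\<lambda>x. exp_cutoff p (c * x $ i + d)) \<in> bump_algebra"
| const: "(\<lambda>x. c) \<in> bump_algebra"
| add: "f \<in> bump_algebra \<Longrightarrow> g \<in> bump_algebra \<Longrightarrow> (\<lambda>x. f x + g x) \<in> bump_algebra"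
| mult: "f \<in> bump_algebra \<Longrightarrow> g \<in> bump_algebra \<Longrightarrow> (\<lambda>x. f x * g x) \<in> bump_algebra"

lemma partial_eq:
  "(f has_derivative f') (at x) \<Longrightarrow> partial i f x = f' (axis i 1)"
  by (simp add: partial_def frechet_derivative_at[symmetric])

text \<open>Differentiability and closure are proved together because the sum and product rules for
  \<open>partial\<close> need the summands and factors to be differentiable.\<close>

lemma bump_algebra_derivative:
  fixes f :: "real ^ 'n::finite \<Rightarrow> real"
  assumes "f \<in> bump_algebra"
  shows "(\<forall>x. f differentiable at x) \<and> partial j f \<in> bump_algebra"
  using assms
proof induction
  case (cutoff p c i d)
  have der: "((\<lambda>x. exp_cutoff p (c * x $ i + d)) has_derivative
      (\<lambda>h. exp_cutoff (exp_cutoff_deriv p) (c * x $ i + d) * (c * h $ i))) (at x)" for x :: "real ^ 'n"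
    using exp_cutoff_has_derivative[of p "c * x $ i + d", unfolded has_field_derivative_def]
    by (rule has_derivative_compose[rotated])
      (auto intro!: derivative_eq_intros bounded_linear_imp_has_derivative bounded_linear_vec_nth)
  have "partial j (\<lambda>x. exp_cutoff p (c * x $ i + d))
      = (\<lambda>x. exp_cutoff (exp_cutoff_deriv p) (c * x $ i + d) * (c * axis j 1 $ i))"
    by (intro ext) (rule partial_eq[OF der])
  then show ?case
    using der by (auto simp: differentiable_def intro!: bump_algebra.intros)
next
  case (const c)
  have "partial j (\<lambda>x. c) = (\<lambda>x. 0)" by (intro ext partial_eq[OF has_derivative_const])
  then show ?case by (auto intro: bump_algebra.intros)
next
  case (add f g)
  have der: "((\<lambda>x. f x + g x) has_derivative
      (\<lambda>h. frechet_derivative f (at x) h + frechet_derivative g (at x) h)) (at x)" for x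
    using add by (intro has_derivative_add) (auto simp: frechet_derivative_works)
  have "partial j (\<lambda>x. f x + g x) = (\<lambda>x. partial j f x + partial j g x)"
    by (intro ext) (simp add: partial_eq[OF der] partial_def)
  then show ?case
    using add by (auto intro: bump_algebra.intros)
next
  case (mult f g)
  have der: "((\<lambda>x. f x * g x) has_derivative
      (\<lambda>h. f x * frechet_derivative g (at x) h + frechet_derivative f (at x) h * g x)) (at x)" for x
    using mult by (intro has_derivative_mult) (auto simp: frechet_derivative_works)
  have "partial j (\<lambda>x. f x * g x) = (\<lambda>x. f x * partial j g x + partial j f x * g x)"
    by (intro ext) (simp add: partial_eq[OF der] partial_def)
  then show ?case
    using mult by (auto intro!: bump_algebra.intros)
qed

lemma bump_algebra_smooth:
  assumes "f \<in> bump_algebra" shows "smooth f"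
proof -
  have "foldr partial js f \<in> bump_algebra" for js
    using assms by (induction js) (auto simp: bump_algebra_derivative)
  then show ?thesis by (auto simp: smooth_def bump_algebra_derivative)
qed

lemma bump_algebra_prod:
  assumes "\<And>i. i \<in> I \<Longrightarrow> f i \<in> bump_algebra"
  shows "(\<lambda>x. \<Prod>i\<in>I. f i x) \<in> bump_algebra"
  using assms by (induction I rule: infinite_finite_induct) (auto intro: bump_algebra.intros)

text \<open>The products are written as c * x + d to match the generator
  \<open>bump_algebra.cutoff\<close>. Scaling the distances to the faces by n sends each factor to
  exp(0) = 1 inside the box, so the bumps tend to its indicator.\<close>

definition box_bump :: "real ^ 'n::finite \<Rightarrow> real ^ 'n \<Rightarrow> nat \<Rightarrow> real ^ 'n \<Rightarrow> real" where
  "box_bump a b n x =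
     (\<Prod>i\<in>UNIV. exp_cutoff 1 (real n * x $ i + - real n * a $ i) *
                exp_cutoff 1 (- real n * x $ i + real n * b $ i))"

lemma exp_cutoff_1: "0 \<le> exp_cutoff 1 s" "exp_cutoff 1 s \<le> 1"
  by (auto simp: exp_cutoff_def)

lemma box_bump_bounds: "0 \<le> box_bump a b n x" "box_bump a b n x \<le> 1"
  unfolding box_bump_def
  by (auto intro!: prod_nonneg prod_le_1 mult_le_one mult_nonneg_nonneg simp: exp_cutoff_1)

lemma box_bump_eq_0: "x \<notin> box a b \<Longrightarrow> box_bump a b n x = 0"
proof -
  assume "x \<notin> box a b"
  then obtain i where "x $ i \<le> a $ i \<or> b $ i \<le> x $ i"
    by (auto simp: mem_box_cart not_less)
  then have "real n * x $ i + - real n * a $ i \<le> 0 \<or> - real n * x $ i + real n * b $ i \<le> 0"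
    by (auto simp: mult_left_mono)
  then have "exp_cutoff 1 (real n * x $ i + - real n * a $ i) *
      exp_cutoff 1 (- real n * x $ i + real n * b $ i) = 0"
    by (auto simp: exp_cutoff_def)
  then show ?thesis unfolding box_bump_def by (intro prod_zero) auto
qed

lemma box_bump_tendsto:
  fixes x :: "real ^ 'n::finite"
  shows "(\<lambda>n. box_bump a b n x) \<longlonglongrightarrow> indicator (box a b) x"
proof (cases "x \<in> box a b")
  case True
  have lim: "(\<lambda>n. exp_cutoff 1 (real n * c)) \<longlonglongrightarrow> 1" if "c > 0" for c
  proof (rule tendsto_cong[THEN iffD1])
    have "(\<lambda>n. exp (- (1 / c) * (1 / real n))) \<longlonglongrightarrow> exp (- (1 / c) * 0)"
      by (intro tendsto_intros lim_1_over_n)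
    then show "(\<lambda>n. exp (- (1 / c) * (1 / real n))) \<longlonglongrightarrow> 1" by simp
    show "\<forall>\<^sub>F n in sequentially. exp (- (1 / c) * (1 / real n)) = exp_cutoff 1 (real n * c)"
      using eventually_gt_at_top[of 0]
      by eventually_elim (use that in \<open>simp add: exp_cutoff_def field_simps\<close>)
  qed
  have "(\<lambda>n. \<Prod>i\<in>UNIV. exp_cutoff 1 (real n * (x $ i - a $ i)) * exp_cutoff 1 (real n * (b $ i - x $ i)))
      \<longlonglongrightarrow> (\<Prod>i\<in>(UNIV::'n set). 1 * 1)"
    using True by (intro tendsto_prod tendsto_mult lim) (auto simp: mem_box_cart)
  then show ?thesis using True by (simp add: box_bump_def algebra_simps)
next
  case False
  then show ?thesis by (simp add: box_bump_eq_0)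
qed

lemma box_bump_test_function:
  assumes "cbox a b \<subseteq> \<Omega>" shows "test_function \<Omega> (box_bump a b n)"
proof -
  have "box_bump a b n \<in> bump_algebra"
    unfolding box_bump_def[abs_def]
    by (intro bump_algebra_prod bump_algebra.mult bump_algebra.cutoff)
  then have "smooth (box_bump a b n)" by (rule bump_algebra_smooth)
  moreover have "\<forall>x. x \<notin> cbox a b \<longrightarrow> box_bump a b n x = 0"
    using box_subset_cbox box_bump_eq_0 by blast
  ultimately show ?thesis
    using assms compact_cbox unfolding test_function_def by blast
qed

text \<open>Continuous functions vanishing off a compact set are bounded. The derivative belongs to
  this class because the test function vanishes identically on the open complement of K.\<close>

lemma test_function_D:
  fixes \<phi> :: "real ^ 'n::finite \<Rightarrow> real"
  assumes "test_function \<Omega> \<phi>"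
  shows "\<phi> \<in> borel_measurable borel" "\<exists>B. \<forall>x. \<bar>\<phi> x\<bar> \<le> B"
    "partial i \<phi> \<in> borel_measurable borel" "\<exists>B. \<forall>x. \<bar>partial i \<phi> x\<bar> \<le> B"
proof -
  obtain K where sm: "smooth \<phi>" and K: "compact K" "\<And>x. x \<notin> K \<Longrightarrow> \<phi> x = 0"
    using assms by (auto simp: test_function_def)
  have bounded: "\<exists>B. \<forall>x. \<bar>f x\<bar> \<le> B" if "continuous_on UNIV f" "\<And>x. x \<notin> K \<Longrightarrow> f x = 0"
    for f :: "real ^ 'n \<Rightarrow> real"
  proof -
    have "bounded (f ` K)"
      using K(1) that(1) by (intro compact_imp_bounded compact_continuous_image)
        (auto intro: continuous_on_subset)
    then obtain B where "\<And>x. x \<in> K \<Longrightarrow> \<bar>f x\<bar> \<le> B" by (auto simp: bounded_iff)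
    then have "\<bar>f x\<bar> \<le> max B 0" for x
      using that(2)[of x] by (cases "x \<in> K") (auto intro: max.coboundedI1)
    then show ?thesis by blast
  qed
  have cont: "continuous_on UNIV f" if "\<forall>x. f differentiable at x" for f :: "real ^ 'n \<Rightarrow> real"
    using that by (simp add: continuous_on_eq_continuous_at differentiable_imp_continuous_within)
  have 1: "continuous_on UNIV \<phi>"
    using sm[unfolded smooth_def, rule_format, of "[]"] by (intro cont) simp
  have 2: "continuous_on UNIV (partial i \<phi>)"
    using sm[unfolded smooth_def, rule_format, of "[i]"] by (intro cont) simp
  have 3: "partial i \<phi> x = 0" if "x \<notin> K" for x
  proof -
    have "(\<phi> has_derivative (\<lambda>h. 0)) (at x)"
      by (rule has_derivative_transform_within_open[of "\<lambda>x. 0" _ _ _ "- K"])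
        (use K that in \<open>auto simp: compact_imp_closed\<close>)
    from partial_eq[OF this] show ?thesis by simp
  qed
  show "\<phi> \<in> borel_measurable borel" "partial i \<phi> \<in> borel_measurable borel"
    using 1 2 by (auto intro: borel_measurable_continuous_onI)
  show "\<exists>B. \<forall>x. \<bar>\<phi> x\<bar> \<le> B" "\<exists>B. \<forall>x. \<bar>partial i \<phi> x\<bar> \<le> B"
    using bounded[OF 1 K(2)] bounded[OF 2 3] by auto
qed

text \<open>Boxes are stable under intersection and generate the Borel sets, so a Dynkin argument
  extends the vanishing of the integral to all Borel sets; Lebesgue sets differ from these by null
  sets, and a function whose integral over every measurable set is zero vanishes almost
  everywhere.\<close>

lemma AE_zero_if_box_integrals_zero:
  fixes h :: "'a::euclidean_space \<Rightarrow> 'b::{banach, second_countable_topology}"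
  assumes int: "integrable lebesgue h"
    and zero: "\<And>a b. (LINT x:box a b|lebesgue. h x) = 0"
  shows "AE x in lebesgue. h x = 0"
proof -
  have set_int: "set_integrable lebesgue A h" if "A \<in> sets lebesgue" for A
    using integrable_mult_indicator[OF that int] by (simp add: set_integrable_def)
  \<comment> \<open>The whole space is not a box but an increasing union of boxes; its integral is
    needed for complements in the induction below.\<close>
  have UNIV: "(LINT x:UNIV|lebesgue. h x) = 0"
  proof -
    define A where "A n = box (- real n *\<^sub>R One) (real n *\<^sub>R One :: 'a)" for n
    have "(\<lambda>n. LINT x:A n|lebesgue. h x) \<longlonglongrightarrow> (LINT x:(\<Union>n. A n)|lebesgue. h x)"
    proof (rule set_integral_cont_up)
      show "incseq A"
        by (auto simp: incseq_def A_def mem_box inner_sum_left_Basis) (smt (verit) of_nat_mono)+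
    qed (auto simp: A_def intro: set_int)
    moreover have "(\<Union>n. A n) = UNIV"
      unfolding A_def using UN_box_eq_UNIV by simp
    ultimately show ?thesis using zero by (auto simp: A_def LIMSEQ_const_iff)
  qed
  have borel: "(LINT x:A|lebesgue. h x) = 0" if "A \<in> sets (borel :: 'a measure)" for A
  proof -
    let ?G = "range (\<lambda>(a, b). box a b :: 'a set)"
    have stable: "Int_stable ?G"
      by (auto simp: Int_stable_def box_Int_box)
    have sig: "sigma_sets UNIV ?G = sets borel"
      by (subst borel_eq_box) (auto intro: sets_measure_of[symmetric])
    from that have "A \<in> sigma_sets UNIV ?G" by (simp add: sig)
    have closed: "?G \<subseteq> Pow UNIV" by simp
    from stable closed \<open>A \<in> sigma_sets UNIV ?G\<close> show ?thesis
    proof (induction rule: sigma_sets_induct_disjoint)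
      case (basic A)
      then show ?case using zero by auto
    next
      case empty
      show ?case by (simp add: set_lebesgue_integral_def)
    next
      case (compl A)
      then have "A \<in> sets lebesgue" by (auto simp: sig)
      moreover from this have "UNIV - A \<in> sets lebesgue" by (intro sets.Diff) auto
      ultimately have "(LINT x:UNIV|lebesgue. h x) = (LINT x:A|lebesgue. h x) + (LINT x:UNIV - A|lebesgue. h x)"
        using set_integral_Un[of A "UNIV - A" lebesgue h] set_int[of A] set_int[of "UNIV - A"]
        by (simp add: Un_Diff_cancel)
      then show ?case using compl UNIV by simp
    next
      case (union A)
      then have A: "A i \<in> sets lebesgue" for i by (auto simp: sig)
      then have "(LINT x:(\<Union>i. A i)|lebesgue. h x) = (\<Sum>i. LINT x:A i|lebesgue. h x)"
        using union(1) by (intro lebesgue_integral_countable_add set_int)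
          (auto simp: disjoint_family_on_def)
      then show ?case using union by simp
    qed
  qed
  interpret sigma_finite_measure "lebesgue :: 'a measure"
  proof (rule sigma_finite_measure.intro, intro exI conjI)
    show "countable (range (\<lambda>n. ball (0 :: 'a) (real n)))" by simp
    show "\<Union>(range (\<lambda>n. ball (0 :: 'a) (real n))) = space lebesgue"
      using reals_Archimedean2 by auto
    show "\<forall>a\<in>range (\<lambda>n. ball (0 :: 'a) (real n)). emeasure lebesgue a \<noteq> \<infinity>"
      using emeasure_bounded_finite[OF bounded_ball] by (auto simp: less_top)
  qed auto
  show ?thesis
  proof (rule density_zero[OF int])
    fix A :: "'a set" assume A: "A \<in> sets lebesgue"
    then obtain S N N' where S: "A = S \<union> N" "N \<subseteq> N'" "N' \<in> null_sets lborel" "S \<in> sets lborel"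
      by (rule sets_completionE)
    have "N' \<in> null_sets lebesgue" using S(3) by (rule null_sets_completionI)
    then have "AE x in lebesgue. x \<notin> N'" by (rule AE_not_in)
    then have "AE x in lebesgue. x \<in> A \<longleftrightarrow> x \<in> S"
      by eventually_elim (use S in auto)
    then have "(LINT x:A|lebesgue. h x) = (LINT x:S|lebesgue. h x)"
      using set_int[OF A] set_int[of S] S(4)
      by (intro set_integral_cong_set) (auto simp: set_borel_measurable_def set_integrable_def)
    then show "(LINT x:A|lebesgue. h x) = 0" using borel[of S] S(4) by simp
  qed
qed

section \<open>Integrability on bounded domains\<close>

lemma L2_component:
  assumes "G \<in> L2 M" shows "(\<lambda>x. G x $ i :: complex) \<in> L2 M"
proof (rule L2_bounded(1)[OF assms, of _ 1])
  show "(\<lambda>x. G x $ i) \<in> borel_measurable M"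
    using measurable_compose[OF L2_measurable[OF assms] borel_measurable_continuous_onI[of "\<lambda>v. v $ i"]]
    by (simp add: continuous_on_component)
qed (simp_all add: Finite_Cartesian_Product.norm_nth_le)

lemma bounded_imp_L2:
  fixes \<phi> :: "'a \<Rightarrow> real"
  assumes "finite_measure M" "\<phi> \<in> borel_measurable M" "\<And>x. \<bar>\<phi> x\<bar> \<le> B"
  shows "\<phi> \<in> L2 M"
proof -
  interpret finite_measure M by fact
  note [measurable] = assms(2)
  have "integrable M (\<lambda>x. (norm (\<phi> x))\<^sup>2)"
  proof (rule integrable_const_bound)
    show "AE x in M. norm ((norm (\<phi> x))\<^sup>2) \<le> B\<^sup>2"
      using power_mono[OF assms(3) abs_ge_zero, of _ 2] by simp
  qed measurable
  then show ?thesis using assms(2) by (simp add: L2_def)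
qed

lemma bounded_mult_L2_integrable:
  fixes u :: "'a \<Rightarrow> 'b::euclidean_space"
  assumes u: "u \<in> L2 M" and fin: "finite_measure M"
    and \<phi>: "\<phi> \<in> borel_measurable M" "\<And>x. \<bar>\<phi> x\<bar> \<le> B"
  shows "integrable M (\<lambda>x. \<phi> x *\<^sub>R u x)"
proof -
  note [measurable] = L2_measurable[OF u] \<phi>(1)
  have "\<phi> \<in> L2 M" by (rule bounded_imp_L2[OF fin \<phi>])
  from L2_mult_integrable[OF this u] show ?thesis
    by (rule Bochner_Integration.integrable_bound) auto
qed

lemma L2_imp_integrable:
  fixes u :: "'a \<Rightarrow> 'b::euclidean_space"
  assumes "finite_measure M" "u \<in> L2 M" shows "integrable M u"
  using bounded_mult_L2_integrable[OF assms(2,1), of "\<lambda>x. 1" 1] by simp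

lemma finite_measure_lebesgue_on_bounded:
  fixes \<Omega> :: "'a::euclidean_space set"
  assumes "open \<Omega>" "bounded \<Omega>" shows "finite_measure (lebesgue_on \<Omega>)"
  using assms by (intro finite_measureI)
    (use emeasure_bounded_finite[of \<Omega>] in
      \<open>auto simp: emeasure_restrict_space space_restrict_space\<close>)

lemma borel_imp_measurable_lebesgue_on:
  "f \<in> borel_measurable borel \<Longrightarrow> f \<in> borel_measurable (lebesgue_on S)"
  by (simp add: measurable_completion measurable_restrict_space1)

lemma test_function_mult_integrable:
  fixes u :: "real ^ 'n::finite \<Rightarrow> 'b::euclidean_space"
  assumes \<Omega>: "open \<Omega>" "bounded \<Omega>" and u: "u \<in> L2 (lebesgue_on \<Omega>)" and \<phi>: "test_function \<Omega> \<phi>"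
  shows "integrable (lebesgue_on \<Omega>) (\<lambda>x. \<phi> x *\<^sub>R u x)"
    and "integrable (lebesgue_on \<Omega>) (\<lambda>x. partial i \<phi> x *\<^sub>R u x)"
proof -
  note fin = finite_measure_lebesgue_on_bounded[OF \<Omega>]
  obtain B where "\<forall>x. \<bar>\<phi> x\<bar> \<le> B" using test_function_D(2)[OF \<phi>] by blast
  then show "integrable (lebesgue_on \<Omega>) (\<lambda>x. \<phi> x *\<^sub>R u x)"
    by (intro bounded_mult_L2_integrable[OF u fin] borel_imp_measurable_lebesgue_on
        test_function_D(1)[OF \<phi>]) auto
  obtain B where "\<forall>x. \<bar>partial i \<phi> x\<bar> \<le> B" using test_function_D(4)[OF \<phi>] by blast
  then show "integrable (lebesgue_on \<Omega>) (\<lambda>x. partial i \<phi> x *\<^sub>R u x)"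
    by (intro bounded_mult_L2_integrable[OF u fin] borel_imp_measurable_lebesgue_on
        test_function_D(3)[OF \<phi>]) auto
qed

text \<open>The fundamental lemma of the calculus of variations. Bumps approximate indicators of
  boxes whose closure lies in \<Omega>, so dominated convergence turns the hypothesis into vanishing
  box integrals.\<close>

lemma test_functions_separate:
  fixes \<Omega> :: "(real ^ 'n::finite) set" and h :: "real ^ 'n \<Rightarrow> complex"
  assumes \<Omega>: "open \<Omega>" and int: "integrable (lebesgue_on \<Omega>) h"
    and zero: "\<And>\<phi>. test_function \<Omega> \<phi> \<Longrightarrow> (LINT x|lebesgue_on \<Omega>. \<phi> x *\<^sub>R h x) = 0"
  shows "AE x in lebesgue_on \<Omega>. h x = 0"
proof -
  have [measurable]: "\<Omega> \<in> sets lebesgue" using \<Omega> by simp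
  define H where "H x = indicator \<Omega> x *\<^sub>R h x" for x
  have H: "integrable lebesgue H"
    using int unfolding H_def by (subst (asm) integrable_restrict_space) simp_all
  have [measurable]: "H \<in> borel_measurable lebesgue" using H by auto
  have box_zero: "(LINT x:box a b|lebesgue. H x) = 0" if sub: "cbox a b \<subseteq> \<Omega>" for a b
  proof -
    have "(\<lambda>n. LINT x|lebesgue. box_bump a b n x *\<^sub>R H x) \<longlonglongrightarrow> (LINT x|lebesgue. indicator (box a b) x *\<^sub>R H x)"
    proof (rule integral_dominated_convergence)
      show "integrable lebesgue (\<lambda>x. norm (H x))" using H by (rule integrable_norm)
      show "AE x in lebesgue. (\<lambda>n. box_bump a b n x *\<^sub>R H x) \<longlonglongrightarrow> indicator (box a b) x *\<^sub>R H x"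
        by (intro AE_I2 tendsto_scaleR box_bump_tendsto tendsto_const)
      show "AE x in lebesgue. norm (box_bump a b n x *\<^sub>R H x) \<le> norm (H x)" for n
        by (intro AE_I2) (simp add: box_bump_bounds mult_left_le_one_le)
      have "box_bump a b n \<in> borel_measurable lebesgue" for n
        using test_function_D(1)[OF box_bump_test_function[OF sub]] by (simp add: measurable_completion)
      then show "(\<lambda>x. box_bump a b n x *\<^sub>R H x) \<in> borel_measurable lebesgue" for n by measurable
      show "(\<lambda>x. indicator (box a b) x *\<^sub>R H x) \<in> borel_measurable lebesgue"
        using H by (intro borel_measurable_scaleR borel_measurable_indicator) auto
    qed
    moreover have "(LINT x|lebesgue. box_bump a b n x *\<^sub>R H x) = 0" for n
      using zero[OF box_bump_test_function[OF sub], of n]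
      by (subst (asm) integral_restrict_space) (simp_all add: H_def mult.commute)
    ultimately show ?thesis by (simp add: set_lebesgue_integral_def LIMSEQ_const_iff)
  qed
  \<comment> \<open>\<open>AE_zero_if_box_integrals_zero\<close> asks for all boxes, but only those
    well inside \<Omega> can be tested. Cutting \<open>H\<close> off to a closed box in \<Omega>
    resolves this: up to the null frontier, any box meets it in a box whose closure stays in
    \<Omega>.\<close>
  have cbox_zero: "AE x in lebesgue. x \<in> cbox c d \<longrightarrow> H x = 0" if sub: "cbox c d \<subseteq> \<Omega>" for c d
  proof -
    have "AE x in lebesgue. indicator (cbox c d) x *\<^sub>R H x = 0"
    proof (rule AE_zero_if_box_integrals_zero)
      show "integrable lebesgue (\<lambda>x. indicator (cbox c d) x *\<^sub>R H x)"
        by (rule integrable_mult_indicator[OF _ H]) simp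
      fix a b :: "real ^ 'n"
      obtain a' b' where ab: "box a b \<inter> box c d = box a' b'"
        by (simp add: box_Int_box)
      have "(LINT x:box a b|lebesgue. indicator (cbox c d) x *\<^sub>R H x) = (LINT x:box a' b'|lebesgue. H x)"
        unfolding set_lebesgue_integral_def
      proof (rule integral_cong_AE)
        have "AE x in lebesgue. x \<notin> cbox c d - box c d"
          using negligible_frontier_interval by (intro AE_not_in) (simp add: negligible_iff_null_sets)
        then show "AE x in lebesgue. indicator (box a b) x *\<^sub>R indicator (cbox c d) x *\<^sub>R H x
            = indicator (box a' b') x *\<^sub>R H x"
          by eventually_elim (use box_subset_cbox[of c d] in \<open>auto simp: ab[symmetric] indicator_def\<close>)
        have ind: "integrable lebesgue (\<lambda>x. indicator A x *\<^sub>R F x)"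
          if "A \<in> sets lebesgue" "integrable lebesgue F" for A and F :: "real ^ 'n \<Rightarrow> complex"
          using that by (rule integrable_mult_indicator)
        show "(\<lambda>x. indicator (box a b) x *\<^sub>R indicator (cbox c d) x *\<^sub>R H x) \<in> borel_measurable lebesgue"
          "(\<lambda>x. indicator (box a' b') x *\<^sub>R H x) \<in> borel_measurable lebesgue"
          by (intro borel_measurable_integrable ind H; simp)+
      qed
      also have "\<dots> = 0"
      proof (cases "box a' b' = {}")
        case True
        then show ?thesis by (simp add: set_lebesgue_integral_def)
      next
        case False
        then have "cbox a' b' = closure (box a' b')" by (simp add: closure_box)
        also have "\<dots> \<subseteq> cbox c d"
          using ab box_subset_cbox[of c d] by (intro closure_minimal) auto
        finally show ?thesis using sub by (intro box_zero) auto
      qed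
      finally show "(LINT x:box a b|lebesgue. indicator (cbox c d) x *\<^sub>R H x) = 0" .
    qed
    then show ?thesis by eventually_elim (auto simp: indicator_def)
  qed
  \<comment> \<open>Countably many closed boxes exhaust \<Omega>, so the exceptional null sets can
    be collected into one.\<close>
  obtain \<D> where \<D>: "countable \<D>" "\<D> \<subseteq> Pow \<Omega>" "\<And>X. X \<in> \<D> \<Longrightarrow> \<exists>a b. X = cbox a b" "\<Union>\<D> = \<Omega>"
    using open_countable_Union_open_cbox[OF \<Omega>] by metis
  have "AE x in lebesgue. \<forall>X\<in>\<D>. x \<in> X \<longrightarrow> H x = 0"
    unfolding AE_ball_countable[OF \<D>(1)]
  proof
    fix X assume X: "X \<in> \<D>"
    then obtain a b where "X = cbox a b" using \<D>(3) by blast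
    then show "AE x in lebesgue. x \<in> X \<longrightarrow> H x = 0"
      using X \<D>(2) cbox_zero by blast
  qed
  then have "AE x in lebesgue. x \<in> \<Omega> \<longrightarrow> h x = 0"
  proof eventually_elim
    case (elim x)
    show ?case
    proof
      assume "x \<in> \<Omega>"
      with elim have "H x = 0" unfolding \<D>(4)[symmetric] by blast
      with \<open>x \<in> \<Omega>\<close> show "h x = 0" by (simp add: H_def)
    qed
  qed
  then show ?thesis by (subst AE_restrict_space_iff) simp_all
qed

section \<open>Uniqueness of weak gradients\<close>

lemma weak_gradientD:
  assumes "is_weak_gradient \<Omega> u G"
  shows "G \<in> L2 (lebesgue_on \<Omega>)"
    and "test_function \<Omega> \<phi> \<Longrightarrow> (LINT x|lebesgue_on \<Omega>. partial i \<phi> x *\<^sub>R u x) =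
        - (LINT x|lebesgue_on \<Omega>. \<phi> x *\<^sub>R (G x $ i))"
  using assms by (simp_all add: is_weak_gradient_def)

lemma weak_gradient_unique:
  fixes \<Omega> :: "(real ^ 'n::finite) set"
  assumes \<Omega>: "open \<Omega>" "bounded \<Omega>"
    and G1: "is_weak_gradient \<Omega> u G1" and G2: "is_weak_gradient \<Omega> u G2"
  shows "AE x in lebesgue_on \<Omega>. G1 x = G2 x"
proof -
  have L2: "(\<lambda>x. G1 x $ i) \<in> L2 (lebesgue_on \<Omega>)" "(\<lambda>x. G2 x $ i) \<in> L2 (lebesgue_on \<Omega>)" for i
    by (rule L2_component[OF weak_gradientD(1)[OF G1]], rule L2_component[OF weak_gradientD(1)[OF G2]])
  have "AE x in lebesgue_on \<Omega>. G1 x $ i - G2 x $ i = 0" for i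
  proof (rule test_functions_separate[OF \<Omega>(1)])
    show "integrable (lebesgue_on \<Omega>) (\<lambda>x. G1 x $ i - G2 x $ i)"
      by (rule L2_imp_integrable[OF finite_measure_lebesgue_on_bounded[OF \<Omega>] L2_diff[OF L2(1)[of i] L2(2)[of i]]])
    fix \<phi> :: "real ^ 'n \<Rightarrow> real" assume \<phi>: "test_function \<Omega> \<phi>"
    have "(LINT x|lebesgue_on \<Omega>. \<phi> x *\<^sub>R (G1 x $ i)) = (LINT x|lebesgue_on \<Omega>. \<phi> x *\<^sub>R (G2 x $ i))"
      using weak_gradientD(2)[OF G1 \<phi>, of i] weak_gradientD(2)[OF G2 \<phi>, of i] by simp
    then show "(LINT x|lebesgue_on \<Omega>. \<phi> x *\<^sub>R (G1 x $ i - G2 x $ i)) = 0"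
      using test_function_mult_integrable(1)[OF \<Omega> L2(1)[of i] \<phi>]
        test_function_mult_integrable(1)[OF \<Omega> L2(2)[of i] \<phi>]
      by (simp add: scaleR_diff_right)
  qed
  then have "AE x in lebesgue_on \<Omega>. \<forall>i. G1 x $ i - G2 x $ i = 0"
    by (simp add: AE_all_countable)
  then show ?thesis by eventually_elim (simp add: vec_eq_iff)
qed

section \<open>The space \<open>H\<^sup>1\<close>\<close>

lemma H1_L2: "u \<in> H1 \<Omega> \<Longrightarrow> u \<in> L2 (lebesgue_on \<Omega>)"
  by (simp add: H1_def)

lemma H1_wgrad: "u \<in> H1 \<Omega> \<Longrightarrow> is_weak_gradient \<Omega> u (wgrad \<Omega> u)"
  unfolding H1_def wgrad_def by (auto simp: some_eq_ex)

lemma H1_wgrad_L2: "u \<in> H1 \<Omega> \<Longrightarrow> wgrad \<Omega> u \<in> L2 (lebesgue_on \<Omega>)"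
  by (rule weak_gradientD(1)[OF H1_wgrad])

lemma H1_I: "u \<in> L2 (lebesgue_on \<Omega>) \<Longrightarrow> is_weak_gradient \<Omega> u G \<Longrightarrow> u \<in> H1 \<Omega>"
  by (auto simp: H1_def)

lemma is_weak_gradient_zero: "is_weak_gradient \<Omega> (\<lambda>x. 0) (\<lambda>x. 0)"
  by (simp add: is_weak_gradient_def L2_zero)

lemma H1_zero: "(\<lambda>x. 0) \<in> H1 \<Omega>"
  by (rule H1_I[OF L2_zero is_weak_gradient_zero])

lemma is_weak_gradient_diff:
  fixes \<Omega> :: "(real ^ 'n::finite) set"
  assumes \<Omega>: "open \<Omega>" "bounded \<Omega>"
    and u: "u \<in> L2 (lebesgue_on \<Omega>)" "is_weak_gradient \<Omega> u G"
    and v: "v \<in> L2 (lebesgue_on \<Omega>)" "is_weak_gradient \<Omega> v H"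
  shows "is_weak_gradient \<Omega> (\<lambda>x. u x - v x) (\<lambda>x. G x - H x)"
  unfolding is_weak_gradient_def
proof (intro conjI allI impI)
  note G = weak_gradientD(1)[OF u(2)] and H = weak_gradientD(1)[OF v(2)]
  show "(\<lambda>x. G x - H x) \<in> L2 (lebesgue_on \<Omega>)" by (rule L2_diff[OF G H])
  fix \<phi> :: "real ^ 'n \<Rightarrow> real" and i assume \<phi>: "test_function \<Omega> \<phi>"
  show "(LINT x|lebesgue_on \<Omega>. partial i \<phi> x *\<^sub>R (u x - v x)) =
      - (LINT x|lebesgue_on \<Omega>. \<phi> x *\<^sub>R ((G x - H x) $ i))"
    using test_function_mult_integrable(2)[OF \<Omega> u(1) \<phi>, of i]
      test_function_mult_integrable(2)[OF \<Omega> v(1) \<phi>, of i]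
      test_function_mult_integrable(1)[OF \<Omega> L2_component[OF G, of i] \<phi>]
      test_function_mult_integrable(1)[OF \<Omega> L2_component[OF H, of i] \<phi>]
      weak_gradientD(2)[OF u(2) \<phi>, of i] weak_gradientD(2)[OF v(2) \<phi>, of i]
    by (simp add: scaleR_diff_right)
qed

lemma H1_diff:
  assumes "open \<Omega>" "bounded \<Omega>" "u \<in> H1 \<Omega>" "v \<in> H1 \<Omega>"
  shows "(\<lambda>x. u x - v x) \<in> H1 \<Omega>"
  by (rule H1_I[OF L2_diff[OF H1_L2 H1_L2] is_weak_gradient_diff[OF _ _ H1_L2 H1_wgrad H1_L2 H1_wgrad]])
    (rule assms)+

lemma wgrad_diff:
  assumes \<Omega>: "open \<Omega>" "bounded \<Omega>" and uv: "u \<in> H1 \<Omega>" "v \<in> H1 \<Omega>"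
  shows "AE x in lebesgue_on \<Omega>. wgrad \<Omega> (\<lambda>x. u x - v x) x = wgrad \<Omega> u x - wgrad \<Omega> v x"
  by (rule weak_gradient_unique[OF \<Omega> H1_wgrad[OF H1_diff[OF \<Omega> uv]]
      is_weak_gradient_diff[OF \<Omega> H1_L2[OF uv(1)] H1_wgrad[OF uv(1)] H1_L2[OF uv(2)] H1_wgrad[OF uv(2)]]])

text \<open>Genuine equality, not only almost everywhere: functions that agree almost everywhere
  have the same weak gradients, so the choice operator is applied to the same predicate.\<close>

lemma wgrad_cong_AE:
  fixes \<Omega> :: "(real ^ 'n::finite) set"
  assumes u: "u \<in> borel_measurable (lebesgue_on \<Omega>)" and v: "v \<in> borel_measurable (lebesgue_on \<Omega>)"
    and eq: "AE x in lebesgue_on \<Omega>. u x = v x"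
  shows "wgrad \<Omega> u = wgrad \<Omega> v"
proof -
  have "(LINT x|lebesgue_on \<Omega>. partial i \<phi> x *\<^sub>R u x) = (LINT x|lebesgue_on \<Omega>. partial i \<phi> x *\<^sub>R v x)"
    if "test_function \<Omega> \<phi>" for \<phi> :: "real ^ 'n \<Rightarrow> real" and i
  proof (rule integral_cong_AE)
    have [measurable]: "partial i \<phi> \<in> borel_measurable (lebesgue_on \<Omega>)"
      by (rule borel_imp_measurable_lebesgue_on[OF test_function_D(3)[OF that]])
    note [measurable] = u v
    show "(\<lambda>x. partial i \<phi> x *\<^sub>R u x) \<in> borel_measurable (lebesgue_on \<Omega>)"
      "(\<lambda>x. partial i \<phi> x *\<^sub>R v x) \<in> borel_measurable (lebesgue_on \<Omega>)"
      by measurable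
    show "AE x in lebesgue_on \<Omega>. partial i \<phi> x *\<^sub>R u x = partial i \<phi> x *\<^sub>R v x"
      using eq by eventually_elim simp
  qed
  then have "is_weak_gradient \<Omega> u G = is_weak_gradient \<Omega> v G" for G
    by (auto simp: is_weak_gradient_def)
  then show ?thesis by (simp add: wgrad_def)
qed

lemma H1k_norm_cong_AE:
  assumes "u \<in> borel_measurable (lebesgue_on \<Omega>)" "v \<in> borel_measurable (lebesgue_on \<Omega>)"
    and "AE x in lebesgue_on \<Omega>. u x = v x"
  shows "H1k_norm \<Omega> k u = H1k_norm \<Omega> k v"
  using wgrad_cong_AE[OF assms] L2_norm_cong_AE[OF assms] by (simp add: H1k_norm_def)

lemma H1k_norm_nonneg: "0 \<le> H1k_norm \<Omega> k v"
  by (simp add: H1k_norm_def)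

lemma L2_norm_wgrad_le_H1k_norm: "L2_norm (lebesgue_on \<Omega>) (wgrad \<Omega> v) \<le> H1k_norm \<Omega> k v"
  unfolding H1k_norm_def by (rule real_le_rsqrt) simp

lemma L2_norm_le_H1k_norm: "k * L2_norm (lebesgue_on \<Omega>) v \<le> H1k_norm \<Omega> k v"
  unfolding H1k_norm_def by (rule real_le_rsqrt) (simp add: power_mult_distrib)

lemma H1k_norm_le:
  assumes "0 \<le> k"
  shows "H1k_norm \<Omega> k v \<le> L2_norm (lebesgue_on \<Omega>) (wgrad \<Omega> v) + k * L2_norm (lebesgue_on \<Omega>) v"
  using sqrt_sum_squares_le_sum[OF L2_norm_nonneg, of "k * L2_norm (lebesgue_on \<Omega>) v"] assms
  by (simp add: H1k_norm_def power_mult_distrib L2_norm_nonneg)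

text \<open>The factor 2 comes from estimating the gradient part and the weighted L^2 part
  separately. It is harmless because the bound is applied to null sequences in
  \<open>has_trace_diff\<close>.\<close>

lemma H1k_norm_diff_le:
  assumes \<Omega>: "open \<Omega>" "bounded \<Omega>" and uv: "u \<in> H1 \<Omega>" "v \<in> H1 \<Omega>" and k: "0 \<le> k"
  shows "H1k_norm \<Omega> k (\<lambda>x. u x - v x)
    \<le> 2 * (H1k_norm \<Omega> k u + H1k_norm \<Omega> k v)"
proof -
  let ?M = "lebesgue_on \<Omega>"
  have "L2_norm ?M (wgrad \<Omega> (\<lambda>x. u x - v x)) = L2_norm ?M (\<lambda>x. wgrad \<Omega> u x - wgrad \<Omega> v x)"
    using wgrad_diff[OF \<Omega> uv] H1_wgrad_L2[OF H1_diff[OF \<Omega> uv]]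
      L2_diff[OF H1_wgrad_L2[OF uv(1)] H1_wgrad_L2[OF uv(2)]]
    by (intro L2_norm_cong_AE) (simp_all add: L2_measurable)
  also have "\<dots> \<le> L2_norm ?M (wgrad \<Omega> u) + L2_norm ?M (wgrad \<Omega> v)"
    by (intro L2_norm_diff_triangle H1_wgrad_L2 uv)
  also have "\<dots> \<le> H1k_norm \<Omega> k u + H1k_norm \<Omega> k v"
    by (intro add_mono L2_norm_wgrad_le_H1k_norm)
  finally have 1: "L2_norm ?M (wgrad \<Omega> (\<lambda>x. u x - v x)) \<le> H1k_norm \<Omega> k u + H1k_norm \<Omega> k v" .
  have "k * L2_norm ?M (\<lambda>x. u x - v x) \<le> k * (L2_norm ?M u + L2_norm ?M v)"
    using k by (intro mult_left_mono L2_norm_diff_triangle H1_L2 uv)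
  also have "\<dots> \<le> H1k_norm \<Omega> k u + H1k_norm \<Omega> k v"
    unfolding distrib_left by (intro add_mono L2_norm_le_H1k_norm)
  finally show ?thesis
    using 1 H1k_norm_le[OF k, of \<Omega> "\<lambda>x. u x - v x"] unfolding mult_2 by linarith
qed

section \<open>Closedness of the weak gradient and completeness of H^1\<close>

lemma L2_limit_integral:
  fixes u :: "nat \<Rightarrow> 'a \<Rightarrow> complex"
  assumes \<phi>: "\<phi> \<in> L2 M" and u: "\<And>n. u n \<in> L2 M" and h: "h \<in> L2 M"
    and lim: "(\<lambda>n. L2_norm M (\<lambda>x. u n x - h x)) \<longlonglongrightarrow> 0"
  shows "(\<lambda>n. LINT x|M. (\<phi> x :: real) *\<^sub>R u n x) \<longlonglongrightarrow> (LINT x|M. \<phi> x *\<^sub>R h x)"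
proof (rule LIM_zero_cancel, rule Lim_null_comparison)
  have int: "integrable M (\<lambda>x. \<phi> x *\<^sub>R v x)" if "v \<in> L2 M" for v :: "'a \<Rightarrow> complex"
  proof (rule Bochner_Integration.integrable_bound[OF L2_mult_integrable[OF \<phi> that]])
    note [measurable] = L2_measurable[OF \<phi>] L2_measurable[OF that]
    show "(\<lambda>x. \<phi> x *\<^sub>R v x) \<in> borel_measurable M" by measurable
  qed simp
  show "\<forall>\<^sub>F n in sequentially. norm ((LINT x|M. \<phi> x *\<^sub>R u n x) - (LINT x|M. \<phi> x *\<^sub>R h x))
      \<le> L2_norm M \<phi> * L2_norm M (\<lambda>x. u n x - h x)"
  proof (intro always_eventually allI)
    fix n
    have "(LINT x|M. \<phi> x *\<^sub>R u n x) - (LINT x|M. \<phi> x *\<^sub>R h x) = (LINT x|M. \<phi> x *\<^sub>R (u n x - h x))"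
      using int[OF u[of n]] int[OF h] by (simp add: scaleR_diff_right)
    also have "norm \<dots> \<le> (LINT x|M. norm (\<phi> x *\<^sub>R (u n x - h x)))"
      by (rule integral_norm_bound)
    also have "\<dots> = (LINT x|M. norm (\<phi> x) * norm (u n x - h x))" by simp
    also have "\<dots> \<le> L2_norm M \<phi> * L2_norm M (\<lambda>x. u n x - h x)"
      by (intro L2_Cauchy_Schwarz \<phi> L2_diff u h)
    finally show "norm ((LINT x|M. \<phi> x *\<^sub>R u n x) - (LINT x|M. \<phi> x *\<^sub>R h x))
      \<le> L2_norm M \<phi> * L2_norm M (\<lambda>x. u n x - h x)" .
  qed
  show "(\<lambda>n. L2_norm M \<phi> * L2_norm M (\<lambda>x. u n x - h x)) \<longlonglongrightarrow> 0"
    using tendsto_mult[OF tendsto_const lim] by simp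
qed

text \<open>Convergence in L^2 implies convergence of the integrals against a fixed test function or
  its derivative, so both sides of the integration by parts formula pass to the limit.\<close>

lemma is_weak_gradient_limit:
  fixes \<Omega> :: "(real ^ 'n::finite) set"
  assumes \<Omega>: "open \<Omega>" "bounded \<Omega>"
    and u: "\<And>n. u n \<in> L2 (lebesgue_on \<Omega>)" "\<And>n. is_weak_gradient \<Omega> (u n) (G n)"
    and h: "h \<in> L2 (lebesgue_on \<Omega>)" "(\<lambda>n. L2_norm (lebesgue_on \<Omega>) (\<lambda>x. u n x - h x)) \<longlonglongrightarrow> 0"
    and H: "H \<in> L2 (lebesgue_on \<Omega>)" "(\<lambda>n. L2_norm (lebesgue_on \<Omega>) (\<lambda>x. G n x - H x)) \<longlonglongrightarrow> 0"
  shows "is_weak_gradient \<Omega> h H"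
  unfolding is_weak_gradient_def
proof (intro conjI allI impI)
  show "H \<in> L2 (lebesgue_on \<Omega>)" by fact
  fix \<phi> :: "real ^ 'n \<Rightarrow> real" and i assume \<phi>: "test_function \<Omega> \<phi>"
  let ?M = "lebesgue_on \<Omega>"
  note fin = finite_measure_lebesgue_on_bounded[OF \<Omega>]
  have \<phi>1: "\<phi> \<in> L2 ?M"
    using test_function_D(1,2)[OF \<phi>] by (auto intro: bounded_imp_L2[OF fin borel_imp_measurable_lebesgue_on])
  have \<phi>2: "partial i \<phi> \<in> L2 ?M"
    using test_function_D(3,4)[OF \<phi>, of i] by (auto intro: bounded_imp_L2[OF fin borel_imp_measurable_lebesgue_on])
  have G: "G n \<in> L2 ?M" for n by (rule weak_gradientD(1)[OF u(2)])
  have 1: "(\<lambda>n. LINT x|?M. partial i \<phi> x *\<^sub>R u n x) \<longlonglongrightarrow> (LINT x|?M. partial i \<phi> x *\<^sub>R h x)"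
    by (rule L2_limit_integral[OF \<phi>2 u(1) h])
  have "(\<lambda>n. L2_norm ?M (\<lambda>x. G n x $ i - H x $ i)) \<longlonglongrightarrow> 0"
  proof (rule Lim_null_comparison[OF _ H(2)], intro always_eventually allI)
    fix n
    have GH: "(\<lambda>x. G n x - H x) \<in> L2 ?M" by (rule L2_diff[OF G H(1)])
    have "(\<lambda>x. G n x $ i - H x $ i) \<in> borel_measurable ?M"
      using L2_measurable[OF L2_component[OF GH, of i]] by simp
    moreover have "AE x in ?M. norm (G n x $ i - H x $ i) \<le> 1 * norm (G n x - H x)"
      using Finite_Cartesian_Product.norm_nth_le[of "G n x - H x" i for x] by simp
    ultimately have "L2_norm ?M (\<lambda>x. G n x $ i - H x $ i) \<le> 1 * L2_norm ?M (\<lambda>x. G n x - H x)"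
      by (rule L2_bounded(2)[OF GH]) simp
    then show "norm (L2_norm ?M (\<lambda>x. G n x $ i - H x $ i)) \<le> L2_norm ?M (\<lambda>x. G n x - H x)"
      by (simp add: L2_norm_nonneg)
  qed
  from L2_limit_integral[OF \<phi>1 L2_component[OF G] L2_component[OF H(1)] this]
  have "(\<lambda>n. - (LINT x|?M. \<phi> x *\<^sub>R (G n x $ i))) \<longlonglongrightarrow> - (LINT x|?M. \<phi> x *\<^sub>R (H x $ i))"
    by (rule tendsto_minus)
  with 1 show "(LINT x|?M. partial i \<phi> x *\<^sub>R h x) = - (LINT x|?M. \<phi> x *\<^sub>R (H x $ i))"
    unfolding weak_gradientD(2)[OF u(2) \<phi>] by (rule LIMSEQ_unique)
qed

lemma geometric_null: "(\<lambda>n. C * (1/2 :: real) ^ n) \<longlonglongrightarrow> 0"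
  using tendsto_mult[OF tendsto_const LIMSEQ_realpow_zero[of "1/2"]] by simp

text \<open>Functions and gradients converge separately in L^2, and closedness of the weak gradient
  joins the two limits. Only L^2 convergence is recorded: the estimate of one step by the previous
  difference involves just its L^2 norm.\<close>

lemma H1_geometric_limit:
  fixes \<Omega> :: "(real ^ 'n::finite) set"
  assumes \<Omega>: "open \<Omega>" "bounded \<Omega>" and k: "0 < k"
    and u: "\<And>n. u n \<in> H1 \<Omega>"
    and geo: "\<And>n. H1k_norm \<Omega> k (\<lambda>x. u (Suc n) x - u n x) \<le> K * (1/2) ^ n"
  obtains h where "h \<in> H1 \<Omega>" "AE x in lebesgue_on \<Omega>. (\<lambda>n. u n x) \<longlonglongrightarrow> h x"
    "(\<lambda>n. L2_norm (lebesgue_on \<Omega>) (\<lambda>x. u n x - h x)) \<longlonglongrightarrow> 0"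
proof -
  let ?M = "lebesgue_on \<Omega>"
  have 1: "L2_norm ?M (\<lambda>x. u (Suc n) x - u n x) \<le> K / k * (1/2) ^ n" for n
    using order_trans[OF L2_norm_le_H1k_norm geo[of n]] k by (simp add: field_simps)
  obtain h where h: "h \<in> L2 ?M" "AE x in ?M. (\<lambda>n. u n x) \<longlonglongrightarrow> h x"
    and h_le: "\<And>n. L2_norm ?M (\<lambda>x. u n x - h x) \<le> 2 * (K / k) * (1/2) ^ n"
    using L2_geometric_limit[OF H1_L2[OF u] 1] by blast
  have 2: "L2_norm ?M (\<lambda>x. wgrad \<Omega> (u (Suc n)) x - wgrad \<Omega> (u n) x) \<le> K * (1/2) ^ n" for n
  proof -
    have "L2_norm ?M (\<lambda>x. wgrad \<Omega> (u (Suc n)) x - wgrad \<Omega> (u n) x)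
        = L2_norm ?M (wgrad \<Omega> (\<lambda>x. u (Suc n) x - u n x))"
      using wgrad_diff[OF \<Omega> u[of "Suc n"] u[of n]] H1_wgrad_L2[OF H1_diff[OF \<Omega> u[of "Suc n"] u[of n]]]
        L2_diff[OF H1_wgrad_L2[OF u[of "Suc n"]] H1_wgrad_L2[OF u[of n]]]
      by (intro L2_norm_cong_AE[symmetric]) (simp_all add: L2_measurable)
    then show ?thesis using order_trans[OF L2_norm_wgrad_le_H1k_norm geo[of n]] by simp
  qed
  obtain H where H: "H \<in> L2 ?M"
    and H_le: "\<And>n. L2_norm ?M (\<lambda>x. wgrad \<Omega> (u n) x - H x) \<le> 2 * K * (1/2) ^ n"
    using L2_geometric_limit[OF H1_wgrad_L2[OF u] 2] by blast
  have h_lim: "(\<lambda>n. L2_norm ?M (\<lambda>x. u n x - h x)) \<longlonglongrightarrow> 0"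
    by (rule Lim_null_comparison[OF _ geometric_null[of "2 * (K / k)"]])
      (use h_le in \<open>simp add: L2_norm_nonneg\<close>)
  have H_lim: "(\<lambda>n. L2_norm ?M (\<lambda>x. wgrad \<Omega> (u n) x - H x)) \<longlonglongrightarrow> 0"
    by (rule Lim_null_comparison[OF _ geometric_null[of "2 * K"]])
      (use H_le in \<open>simp add: L2_norm_nonneg\<close>)
  have "is_weak_gradient \<Omega> h H"
    by (rule is_weak_gradient_limit[OF \<Omega> H1_L2[OF u] H1_wgrad[OF u] h(1) h_lim H H_lim])
  then have "h \<in> H1 \<Omega>" by (rule H1_I[OF h(1)])
  then show ?thesis using h(2) h_lim by (rule that)
qed

section \<open>Traces and the Helmholtz form\<close>

lemma smooth_diff:
  assumes f: "smooth f" and g: "smooth g"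
  shows "smooth (\<lambda>x. f x - g x)"
proof -
  have df: "foldr partial js f differentiable at x" and dg: "foldr partial js g differentiable at x" for js x
    using f g by (auto simp: smooth_def)
  have der: "((\<lambda>x. foldr partial js f x - foldr partial js g x) has_derivative
      (\<lambda>h. frechet_derivative (foldr partial js f) (at x) h
         - frechet_derivative (foldr partial js g) (at x) h)) (at x)" for js x
    using df dg by (intro has_derivative_diff) (auto simp: frechet_derivative_works)
  have eq: "foldr partial js (\<lambda>x. f x - g x) = (\<lambda>x. foldr partial js f x - foldr partial js g x)" for js
  proof (induction js)
    case (Cons j js)
    have "partial j (\<lambda>x. foldr partial js f x - foldr partial js g x)
        = (\<lambda>x. partial j (foldr partial js f) x - partial j (foldr partial js g) x)"
      by (intro ext) (simp add: partial_eq[OF der] partial_def)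
    then show ?case using Cons by simp
  qed simp
  show ?thesis unfolding smooth_def eq using der by (auto simp: differentiable_def)
qed

lemma has_trace_D: "has_trace \<Omega> v t \<Longrightarrow> v \<in> H1 \<Omega>" "has_trace \<Omega> v t \<Longrightarrow> t \<in> L2 (bdry \<Omega>)"
  by (simp_all add: has_trace_def)

text \<open>Differences of the two approximating sequences approximate the difference. This is
  needed because subtracting two Helmholtz problems subtracts their boundary terms as well.\<close>

lemma has_trace_diff:
  fixes \<Omega> :: "(real ^ 'n::finite) set"
  assumes \<Omega>: "open \<Omega>" "bounded \<Omega>" and v: "has_trace \<Omega> v t" and w: "has_trace \<Omega> w s"
  shows "has_trace \<Omega> (\<lambda>x. v x - w x) (\<lambda>x. t x - s x)"
proof -
  obtain \<phi> :: "nat \<Rightarrow> real ^ 'n \<Rightarrow> complex" where \<phi>: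
    "\<And>j. smooth (\<phi> j)" "\<And>j. \<phi> j \<in> H1 \<Omega>" "\<And>j. \<phi> j \<in> L2 (bdry \<Omega>)"
    "(\<lambda>j. H1k_norm \<Omega> 1 (\<lambda>x. \<phi> j x - v x)) \<longlonglongrightarrow> 0"
    "(\<lambda>j. L2_norm (bdry \<Omega>) (\<lambda>x. \<phi> j x - t x)) \<longlonglongrightarrow> 0"
    using v unfolding has_trace_def by blast
  obtain \<psi> :: "nat \<Rightarrow> real ^ 'n \<Rightarrow> complex" where \<psi>:
    "\<And>j. smooth (\<psi> j)" "\<And>j. \<psi> j \<in> H1 \<Omega>" "\<And>j. \<psi> j \<in> L2 (bdry \<Omega>)"
    "(\<lambda>j. H1k_norm \<Omega> 1 (\<lambda>x. \<psi> j x - w x)) \<longlonglongrightarrow> 0"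
    "(\<lambda>j. L2_norm (bdry \<Omega>) (\<lambda>x. \<psi> j x - s x)) \<longlonglongrightarrow> 0"
    using w unfolding has_trace_def by blast
  note [simp] = has_trace_D[OF v] has_trace_D[OF w]
  define \<zeta> where "\<zeta> j x = \<phi> j x - \<psi> j x" for j x
  have "(\<lambda>j. H1k_norm \<Omega> 1 (\<lambda>x. \<zeta> j x - (v x - w x))) \<longlonglongrightarrow> 0"
  proof (rule Lim_null_comparison, intro always_eventually allI)
    show "(\<lambda>j. 2 * (H1k_norm \<Omega> 1 (\<lambda>x. \<phi> j x - v x) + H1k_norm \<Omega> 1 (\<lambda>x. \<psi> j x - w x))) \<longlonglongrightarrow> 0"
      using tendsto_mult[OF tendsto_const[of 2] tendsto_add[OF \<phi>(4) \<psi>(4)]] by simp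
    fix j
    have "H1k_norm \<Omega> 1 (\<lambda>x. (\<phi> j x - v x) - (\<psi> j x - w x))
        \<le> 2 * (H1k_norm \<Omega> 1 (\<lambda>x. \<phi> j x - v x) + H1k_norm \<Omega> 1 (\<lambda>x. \<psi> j x - w x))"
      using \<Omega> \<phi>(2) \<psi>(2) by (intro H1k_norm_diff_le H1_diff) simp_all
    then show "norm (H1k_norm \<Omega> 1 (\<lambda>x. \<zeta> j x - (v x - w x)))
        \<le> 2 * (H1k_norm \<Omega> 1 (\<lambda>x. \<phi> j x - v x) + H1k_norm \<Omega> 1 (\<lambda>x. \<psi> j x - w x))"
      by (simp add: \<zeta>_def H1k_norm_nonneg algebra_simps)
  qed
  moreover have "(\<lambda>j. L2_norm (bdry \<Omega>) (\<lambda>x. \<zeta> j x - (t x - s x))) \<longlonglongrightarrow> 0"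
  proof (rule Lim_null_comparison, intro always_eventually allI)
    show "(\<lambda>j. L2_norm (bdry \<Omega>) (\<lambda>x. \<phi> j x - t x) + L2_norm (bdry \<Omega>) (\<lambda>x. \<psi> j x - s x)) \<longlonglongrightarrow> 0"
      using tendsto_add[OF \<phi>(5) \<psi>(5)] by simp
    fix j
    have "L2_norm (bdry \<Omega>) (\<lambda>x. (\<phi> j x - t x) - (\<psi> j x - s x))
        \<le> L2_norm (bdry \<Omega>) (\<lambda>x. \<phi> j x - t x) + L2_norm (bdry \<Omega>) (\<lambda>x. \<psi> j x - s x)"
      using \<phi>(3) \<psi>(3) by (intro L2_norm_diff_triangle L2_diff) simp_all
    then show "norm (L2_norm (bdry \<Omega>) (\<lambda>x. \<zeta> j x - (t x - s x)))
        \<le> L2_norm (bdry \<Omega>) (\<lambda>x. \<phi> j x - t x) + L2_norm (bdry \<Omega>) (\<lambda>x. \<psi> j x - s x)"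
      by (simp add: \<zeta>_def L2_norm_nonneg algebra_simps)
  qed
  moreover have "smooth (\<zeta> j)" "\<zeta> j \<in> H1 \<Omega>" "\<zeta> j \<in> L2 (bdry \<Omega>)" for j
    using smooth_diff[OF \<phi>(1) \<psi>(1)] H1_diff[OF \<Omega> \<phi>(2) \<psi>(2)] L2_diff[OF \<phi>(3) \<psi>(3)]
    by (simp_all add: \<zeta>_def[abs_def])
  ultimately show ?thesis
    using \<Omega> by (auto simp: has_trace_def intro!: H1_diff L2_diff)
qed

section \<open>The Helmholtz problem as a problem with data\<close>

text \<open>All lower-order terms except \<open>k\<^sup>2 w\<close> are moved to the right-hand side, so that the linearized
  problem, the nonlinear problem and the iteration differ only in the volume source \<open>F\<close>.\<close>

definition helmholtz_source ::
  "(real ^ 'n::finite) set \<Rightarrow> real \<Rightarrow> (real ^ 'n \<Rightarrow> complex) \<Rightarrow> (real ^ 'n \<Rightarrow> complex) \<Rightarrow>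
   (real ^ 'n \<Rightarrow> complex) \<Rightarrow> bool" where
  "helmholtz_source \<Omega> k F g w \<longleftrightarrow>
     (\<exists>t. has_trace \<Omega> w t \<and>
        (\<forall>v s. has_trace \<Omega> v s \<longrightarrow>
           grad_ip \<Omega> w v - complex_of_real (k\<^sup>2) * L2_ip (lebesgue_on \<Omega>) w v
             + \<i> * complex_of_real k * L2_ip (bdry \<Omega>) t s = data_rhs \<Omega> F g v s))"

text \<open>The cubic Kerr term with the modulus frozen at \<Phi>. The cutoff to D is built in, so
  that it can serve as a volume source on all of \<Omega>.\<close>

definition kerr ::
  "(real ^ 'n::finite) set \<Rightarrow> (real ^ 'n \<Rightarrow> complex) \<Rightarrow> (real ^ 'n \<Rightarrow> complex) \<Rightarrow> real ^ 'n \<Rightarrow> complex" where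
  "kerr D \<Phi> w x = complex_of_real (indicator D x * (cmod (\<Phi> x))\<^sup>2) * w x"

lemma L2_norm_cmult: "L2_norm M (\<lambda>x. c * f x :: complex) = cmod c * L2_norm M f"
  by (simp add: L2_norm_def norm_mult power_mult_distrib real_sqrt_mult)

lemma slobodeckij_sq_zero [simp]: "slobodeckij_sq \<Omega> (\<lambda>x. 0) = 0"
  by (simp add: slobodeckij_sq_def)

lemma Hhalf_zero: "(\<lambda>x. 0) \<in> Hhalf \<Omega>"
  by (simp add: Hhalf_def L2_zero)

lemma C_data_zero [simp]: "C_data \<Omega> F (\<lambda>x. 0) = L2_norm (lebesgue_on \<Omega>) F"
  by (simp add: C_data_def Hhalf_norm_def)

lemma C_data_nonneg: "0 \<le> C_data \<Omega> f g"
  by (simp add: C_data_def Hhalf_norm_def L2_norm_nonneg)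

lemma grad_ip_diff_left:
  fixes \<Omega> :: "(real ^ 'n::finite) set"
  assumes \<Omega>: "open \<Omega>" "bounded \<Omega>" and u: "u \<in> H1 \<Omega>" and w: "w \<in> H1 \<Omega>" and v: "v \<in> H1 \<Omega>"
  shows "grad_ip \<Omega> (\<lambda>x. u x - w x) v = grad_ip \<Omega> u v - grad_ip \<Omega> w v"
proof -
  let ?M = "lebesgue_on \<Omega>"
  have eq: "grad_ip \<Omega> a v = (\<Sum>i\<in>UNIV. L2_ip ?M (\<lambda>x. wgrad \<Omega> a x $ i) (\<lambda>x. wgrad \<Omega> v x $ i))"
    if a: "a \<in> H1 \<Omega>" for a
    unfolding grad_ip_def L2_ip_def
    by (intro Bochner_Integration.integral_sum L2_ip_integrable)
      (rule L2_component[OF H1_wgrad_L2[OF a]], rule L2_component[OF H1_wgrad_L2[OF v]])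
  have "L2_ip ?M (\<lambda>x. wgrad \<Omega> (\<lambda>x. u x - w x) x $ i) (\<lambda>x. wgrad \<Omega> v x $ i)
      = L2_ip ?M (\<lambda>x. wgrad \<Omega> u x $ i) (\<lambda>x. wgrad \<Omega> v x $ i)
        - L2_ip ?M (\<lambda>x. wgrad \<Omega> w x $ i) (\<lambda>x. wgrad \<Omega> v x $ i)" for i
  proof -
    have c: "(\<lambda>x. wgrad \<Omega> a x $ i) \<in> L2 ?M" if "a \<in> H1 \<Omega>" for a
      by (rule L2_component[OF H1_wgrad_L2[OF that]])
    have "L2_ip ?M (\<lambda>x. wgrad \<Omega> (\<lambda>x. u x - w x) x $ i) (\<lambda>x. wgrad \<Omega> v x $ i)
        = L2_ip ?M (\<lambda>x. wgrad \<Omega> u x $ i - wgrad \<Omega> w x $ i) (\<lambda>x. wgrad \<Omega> v x $ i)"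
    proof (rule L2_ip_cong_AE_left)
      show "AE x in ?M. wgrad \<Omega> (\<lambda>x. u x - w x) x $ i = wgrad \<Omega> u x $ i - wgrad \<Omega> w x $ i"
        using wgrad_diff[OF \<Omega> u w] by eventually_elim simp
    qed (rule L2_measurable[OF c[OF H1_diff[OF \<Omega> u w]]] L2_measurable[OF L2_diff[OF c[OF u] c[OF w]]]
        L2_measurable[OF c[OF v]])+
    then show ?thesis by (simp add: L2_ip_diff_left[OF c[OF u] c[OF w] c[OF v]])
  qed
  then show ?thesis
    by (simp add: eq[OF H1_diff[OF \<Omega> u w]] eq[OF u] eq[OF w] sum_subtractf)
qed

lemma helmholtz_source_cong_AE:
  assumes F: "F \<in> borel_measurable (lebesgue_on \<Omega>)" and F': "F' \<in> borel_measurable (lebesgue_on \<Omega>)"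
    and eq: "AE x in lebesgue_on \<Omega>. F x = F' x"
  shows "helmholtz_source \<Omega> k F g w = helmholtz_source \<Omega> k F' g w"
proof -
  have "data_rhs \<Omega> F g v s = data_rhs \<Omega> F' g v s" if "has_trace \<Omega> v s" for v s
    using L2_ip_cong_AE_left[OF F F' L2_measurable[OF H1_L2[OF has_trace_D(1)[OF that]]] eq]
    by (simp add: data_rhs_def)
  then show ?thesis by (auto simp: helmholtz_source_def)
qed

text \<open>The common boundary datum g cancels, so an estimate of the difference sees only the L^2
  norm of the difference of the sources.\<close>

lemma helmholtz_source_diff:
  fixes \<Omega> :: "(real ^ 'n::finite) set"
  assumes \<Omega>: "open \<Omega>" "bounded \<Omega>"
    and u: "helmholtz_source \<Omega> k F g u" and w: "helmholtz_source \<Omega> k F' g w"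
    and F: "F \<in> L2 (lebesgue_on \<Omega>)" "F' \<in> L2 (lebesgue_on \<Omega>)"
  shows "helmholtz_source \<Omega> k (\<lambda>x. F x - F' x) (\<lambda>x. 0) (\<lambda>x. u x - w x)"
proof -
  obtain t where t: "has_trace \<Omega> u t"
    "\<And>v s. has_trace \<Omega> v s \<Longrightarrow> grad_ip \<Omega> u v - complex_of_real (k\<^sup>2) * L2_ip (lebesgue_on \<Omega>) u v
             + \<i> * complex_of_real k * L2_ip (bdry \<Omega>) t s = data_rhs \<Omega> F g v s"
    using u by (auto simp: helmholtz_source_def)
  obtain t' where t': "has_trace \<Omega> w t'"
    "\<And>v s. has_trace \<Omega> v s \<Longrightarrow> grad_ip \<Omega> w v - complex_of_real (k\<^sup>2) * L2_ip (lebesgue_on \<Omega>) w v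
             + \<i> * complex_of_real k * L2_ip (bdry \<Omega>) t' s = data_rhs \<Omega> F' g v s"
    using w by (auto simp: helmholtz_source_def)
  note H1 = has_trace_D(1)[OF t(1)] has_trace_D(1)[OF t'(1)]
  have "grad_ip \<Omega> (\<lambda>x. u x - w x) v
        - complex_of_real (k\<^sup>2) * L2_ip (lebesgue_on \<Omega>) (\<lambda>x. u x - w x) v
        + \<i> * complex_of_real k * L2_ip (bdry \<Omega>) (\<lambda>x. t x - t' x) s
      = data_rhs \<Omega> (\<lambda>x. F x - F' x) (\<lambda>x. 0) v s" if vs: "has_trace \<Omega> v s" for v s
  proof -
    note v = has_trace_D[OF vs]
    have zero: "L2_ip (bdry \<Omega>) (\<lambda>x. 0) s = 0" by (simp add: L2_ip_def)
    show ?thesis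
      using arg_cong2[OF t(2)[OF vs] t'(2)[OF vs], of "(-)"]
      by (simp add: grad_ip_diff_left[OF \<Omega> H1 v(1)]
          L2_ip_diff_left[OF H1_L2[OF H1(1)] H1_L2[OF H1(2)] H1_L2[OF v(1)]]
          L2_ip_diff_left[OF has_trace_D(2)[OF t(1)] has_trace_D(2)[OF t'(1)] v(2)]
          L2_ip_diff_left[OF F H1_L2[OF v(1)]] data_rhs_def zero algebra_simps)
  qed
  then show ?thesis
    using has_trace_diff[OF \<Omega> t(1) t'(1)] by (auto simp: helmholtz_source_def)
qed

lemma Linf_norm_nonneg:
  assumes "f \<in> borel_measurable M" shows "0 \<le> Linf_norm M f"
proof (cases "emeasure M (space M) = 0")
  \<comment> \<open>On a null space the essential supremum is -\<infinity>, which
    \<open>real_of_ereal\<close> sends to 0.\<close>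
  case True
  then show ?thesis
    using assms by (simp add: Linf_norm_def esssup_zero_space)
next
  case False
  note [measurable] = assms
  have "esssup M (\<lambda>x. 0) \<le> esssup M (\<lambda>x. ereal (cmod (f x)))"
    by (intro esssup_mono) auto
  then show ?thesis
    by (simp add: Linf_norm_def esssup_const[OF False] real_of_ereal_pos)
qed

section \<open>The Kerr term as a bounded source\<close>

locale kerr_domain =
  fixes \<Omega> D :: "(real ^ 'n::finite) set"
  assumes open_Omega: "open \<Omega>" and bounded_Omega: "bounded \<Omega>"
    and open_D: "open D" and D_subset: "D \<subseteq> \<Omega>"
begin

text \<open>A pointwise form of the bound, stated almost everywhere in \<Omega>, so that it combines
  with identities and limits that hold almost everywhere in \<Omega>. The next lemmas translate
  between it and the \<open>Linf\<close> norm of the stability hypothesis.\<close>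

definition bounded_on_D :: "real \<Rightarrow> (real ^ 'n \<Rightarrow> complex) \<Rightarrow> bool" where
  "bounded_on_D B \<Phi> \<longleftrightarrow> (AE x in lebesgue_on \<Omega>. x \<in> D \<longrightarrow> cmod (\<Phi> x) \<le> B)"

lemma AE_lebesgue_on_D:
  "(AE x in lebesgue_on D. P x) \<longleftrightarrow> (AE x in lebesgue_on \<Omega>. x \<in> D \<longrightarrow> P x)"
proof -
  have "(AE x in lebesgue. x \<in> D \<longrightarrow> P x) \<longleftrightarrow> (AE x in lebesgue. x \<in> \<Omega> \<longrightarrow> x \<in> D \<longrightarrow> P x)"
    using D_subset by (intro AE_cong) auto
  then show ?thesis
    using open_Omega open_D by (simp add: AE_restrict_space_iff)
qed

lemma measurable_on_D:
  "f \<in> borel_measurable (lebesgue_on \<Omega>) \<Longrightarrow> f \<in> borel_measurable (lebesgue_on D)"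
  by (rule measurable_restrict_mono[OF _ D_subset])

lemma bounded_on_D_imp_Linf:
  assumes \<Phi>: "\<Phi> \<in> borel_measurable (lebesgue_on \<Omega>)" "bounded_on_D B \<Phi>" and B: "0 \<le> B"
  shows "\<Phi> \<in> Linf (lebesgue_on D)" "Linf_norm (lebesgue_on D) \<Phi> \<le> B"
proof -
  have [measurable]: "\<Phi> \<in> borel_measurable (lebesgue_on D)" by (rule measurable_on_D[OF \<Phi>(1)])
  have le: "esssup (lebesgue_on D) (\<lambda>x. ereal (cmod (\<Phi> x))) \<le> ereal B"
    using \<Phi>(2) by (intro esssup_I) (simp_all add: bounded_on_D_def AE_lebesgue_on_D)
  then show "\<Phi> \<in> Linf (lebesgue_on D)"
    by (auto simp: Linf_def intro: le_less_trans)
  show "Linf_norm (lebesgue_on D) \<Phi> \<le> B"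
    using le B unfolding Linf_norm_def
    by (cases "esssup (lebesgue_on D) (\<lambda>x. ereal (cmod (\<Phi> x)))") auto
qed

lemma Linf_imp_bounded_on_D:
  assumes "\<Phi> \<in> Linf (lebesgue_on D)" "Linf_norm (lebesgue_on D) \<Phi> \<le> B"
  shows "bounded_on_D B \<Phi>"
proof -
  let ?S = "esssup (lebesgue_on D) (\<lambda>x. ereal (cmod (\<Phi> x)))"
  have "AE x in lebesgue_on D. ereal (cmod (\<Phi> x)) \<le> ?S" by (rule esssup_AE)
  then have "AE x in lebesgue_on D. cmod (\<Phi> x) \<le> B"
  proof eventually_elim
    case (elim x)
    then show ?case
      using assms by (cases ?S) (auto simp: Linf_def Linf_norm_def)
  qed
  then show ?thesis by (simp add: AE_lebesgue_on_D bounded_on_D_def)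
qed

lemma kerr_L2:
  assumes \<Phi>: "\<Phi> \<in> L2 (lebesgue_on \<Omega>)" "bounded_on_D B \<Phi>" and w: "w \<in> L2 (lebesgue_on \<Omega>)"
  shows "kerr D \<Phi> w \<in> L2 (lebesgue_on \<Omega>)"
    and "L2_norm (lebesgue_on \<Omega>) (kerr D \<Phi> w) \<le> B\<^sup>2 * L2_norm (lebesgue_on \<Omega>) w"
proof -
  note [measurable] = L2_measurable[OF \<Phi>(1)] L2_measurable[OF w]
  have "D \<inter> \<Omega> \<in> sets (lebesgue_on \<Omega>)"
    using open_Omega open_D by (simp add: sets_restrict_space_iff)
  then have [measurable]: "(\<lambda>x. indicator D x :: real) \<in> borel_measurable (lebesgue_on \<Omega>)"
    by (simp add: borel_measurable_indicator_iff)
  have meas: "kerr D \<Phi> w \<in> borel_measurable (lebesgue_on \<Omega>)"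
    unfolding kerr_def[abs_def] by measurable
  have le: "AE x in lebesgue_on \<Omega>. cmod (kerr D \<Phi> w x) \<le> B\<^sup>2 * cmod (w x)"
    using \<Phi>(2) unfolding bounded_on_D_def
  proof eventually_elim
    case (elim x)
    have "(cmod (\<Phi> x))\<^sup>2 \<le> B\<^sup>2" if "x \<in> D"
      using elim that by (intro power_mono) auto
    then show ?case
      by (cases "x \<in> D") (auto simp: kerr_def norm_mult norm_power intro: mult_right_mono)
  qed
  show "kerr D \<Phi> w \<in> L2 (lebesgue_on \<Omega>)"
    and "L2_norm (lebesgue_on \<Omega>) (kerr D \<Phi> w) \<le> B\<^sup>2 * L2_norm (lebesgue_on \<Omega>) w"
    by (rule L2_bounded[OF w meas le]; simp)+
qed

lemma L2_ip_D_kerr: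
  "L2_ip (lebesgue_on D) (\<lambda>x. complex_of_real ((cmod (u x))\<^sup>2) * u x) v
    = L2_ip (lebesgue_on \<Omega>) (kerr D u u) v"
proof -
  have "L2_ip (lebesgue_on D) (\<lambda>x. complex_of_real ((cmod (u x))\<^sup>2) * u x) v
      = (LINT x|lebesgue. indicator D x *\<^sub>R (complex_of_real ((cmod (u x))\<^sup>2) * u x * cnj (v x)))"
    unfolding L2_ip_def using open_D by (intro integral_restrict_space) simp
  also have "\<dots> = (LINT x|lebesgue. indicator \<Omega> x *\<^sub>R (kerr D u u x * cnj (v x)))"
    using D_subset by (intro Bochner_Integration.integral_cong) (auto simp: kerr_def indicator_def)
  also have "\<dots> = L2_ip (lebesgue_on \<Omega>) (kerr D u u) v"
    unfolding L2_ip_def using open_Omega by (intro integral_restrict_space[symmetric]) simp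
  finally show ?thesis .
qed

lemma helm_form_kerr:
  assumes \<Phi>: "\<Phi> \<in> L2 (lebesgue_on \<Omega>)" "bounded_on_D B \<Phi>"
    and w: "w \<in> L2 (lebesgue_on \<Omega>)" and v: "v \<in> L2 (lebesgue_on \<Omega>)"
  shows "helm_form \<Omega> D k \<epsilon> c \<Phi> w t v s
    = grad_ip \<Omega> w v - complex_of_real (k\<^sup>2) * L2_ip (lebesgue_on \<Omega>) w v
      + \<i> * complex_of_real k * L2_ip (bdry \<Omega>) t s
      - complex_of_real (k\<^sup>2 * (c * \<epsilon>)) * L2_ip (lebesgue_on \<Omega>) (kerr D \<Phi> w) v"
proof -
  have "(\<lambda>x. complex_of_real (k\<^sup>2 * (1 + c * indicator D x * \<epsilon> * (cmod (\<Phi> x))\<^sup>2)) * w x)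
      = (\<lambda>x. complex_of_real (k\<^sup>2) * w x + complex_of_real (k\<^sup>2 * (c * \<epsilon>)) * kerr D \<Phi> w x)"
    by (simp add: kerr_def algebra_simps)
  moreover have "L2_ip (lebesgue_on \<Omega>)
        (\<lambda>x. complex_of_real (k\<^sup>2) * w x + complex_of_real (k\<^sup>2 * (c * \<epsilon>)) * kerr D \<Phi> w x) v
      = complex_of_real (k\<^sup>2) * L2_ip (lebesgue_on \<Omega>) w v
        + complex_of_real (k\<^sup>2 * (c * \<epsilon>)) * L2_ip (lebesgue_on \<Omega>) (kerr D \<Phi> w) v"
    using kerr_L2(1)[OF \<Phi> w] w v by (simp only: L2_ip_add_left L2_cmult L2_ip_cmult_left)
  ultimately show ?thesis unfolding helm_form_def by simp
qed

text \<open>The source on the right contains \<open>w\<close> itself: this is an identity satisfied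
  by a solution rather than a problem to be solved. It gives problems with different \<Phi> a common
  left-hand side, so that they can be subtracted.\<close>

lemma linearized_solution_iff:
  assumes \<Phi>: "\<Phi> \<in> L2 (lebesgue_on \<Omega>)" "bounded_on_D B \<Phi>"
    and f: "f \<in> L2 (lebesgue_on \<Omega>)"
  shows "linearized_solution \<Omega> D k \<epsilon> \<Phi> f g w \<longleftrightarrow> w \<in> H1 \<Omega> \<and>
    helmholtz_source \<Omega> k (\<lambda>x. f x + complex_of_real (k\<^sup>2 * \<epsilon>) * kerr D \<Phi> w x) g w"
proof -
  have "helm_form \<Omega> D k \<epsilon> 1 \<Phi> w t v s = data_rhs \<Omega> f g v s \<longleftrightarrow>
      grad_ip \<Omega> w v - complex_of_real (k\<^sup>2) * L2_ip (lebesgue_on \<Omega>) w v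
        + \<i> * complex_of_real k * L2_ip (bdry \<Omega>) t s
      = data_rhs \<Omega> (\<lambda>x. f x + complex_of_real (k\<^sup>2 * \<epsilon>) * kerr D \<Phi> w x) g v s"
    if w: "w \<in> H1 \<Omega>" and v: "v \<in> H1 \<Omega>" for t v s
  proof -
    have "L2_ip (lebesgue_on \<Omega>) (\<lambda>x. f x + complex_of_real (k\<^sup>2 * \<epsilon>) * kerr D \<Phi> w x) v
        = L2_ip (lebesgue_on \<Omega>) f v
          + complex_of_real (k\<^sup>2 * \<epsilon>) * L2_ip (lebesgue_on \<Omega>) (kerr D \<Phi> w) v"
      using f kerr_L2(1)[OF \<Phi> H1_L2[OF w]] H1_L2[OF v]
      by (simp only: L2_ip_add_left L2_cmult L2_ip_cmult_left)
    then show ?thesis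
      unfolding helm_form_kerr[OF \<Phi> H1_L2[OF w] H1_L2[OF v]] data_rhs_def
      by (simp add: diff_eq_eq add_ac)
  qed
  then have "(\<forall>v\<in>H1 \<Omega>. \<forall>s. has_trace \<Omega> v s \<longrightarrow> helm_form \<Omega> D k \<epsilon> 1 \<Phi> w t v s = data_rhs \<Omega> f g v s)
      \<longleftrightarrow> (\<forall>v s. has_trace \<Omega> v s \<longrightarrow>
        grad_ip \<Omega> w v - complex_of_real (k\<^sup>2) * L2_ip (lebesgue_on \<Omega>) w v
          + \<i> * complex_of_real k * L2_ip (bdry \<Omega>) t s
        = data_rhs \<Omega> (\<lambda>x. f x + complex_of_real (k\<^sup>2 * \<epsilon>) * kerr D \<Phi> w x) g v s)"
    if "w \<in> H1 \<Omega>" for t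
    using that has_trace_D(1) by blast
  then show ?thesis
    unfolding linearized_solution_def helm_solves_def helmholtz_source_def by blast
qed

lemma iteration_step_iff:
  assumes a: "a \<in> L2 (lebesgue_on \<Omega>)" "bounded_on_D B a"
    and f: "f \<in> L2 (lebesgue_on \<Omega>)"
  shows "iteration_step \<Omega> D k \<epsilon> f g a w \<longleftrightarrow>
    linearized_solution \<Omega> D k (2 * \<epsilon>) a
      (\<lambda>x. f x - complex_of_real (k\<^sup>2 * \<epsilon>) * kerr D a a x) g w"
proof -
  have "helm_form \<Omega> D k \<epsilon> 2 a w t v s = helm_form \<Omega> D k (2 * \<epsilon>) 1 a w t v s" for t v s
    by (simp add: helm_form_def ac_simps)
  moreover have "- complex_of_real (k\<^sup>2 * \<epsilon>) *
        L2_ip (lebesgue_on D) (\<lambda>x. complex_of_real ((cmod (a x))\<^sup>2) * a x) v + data_rhs \<Omega> f g v s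
      = data_rhs \<Omega> (\<lambda>x. f x - complex_of_real (k\<^sup>2 * \<epsilon>) * kerr D a a x) g v s"
    if v: "v \<in> H1 \<Omega>" for v s
  proof -
    have "L2_ip (lebesgue_on \<Omega>) (\<lambda>x. f x - complex_of_real (k\<^sup>2 * \<epsilon>) * kerr D a a x) v
        = L2_ip (lebesgue_on \<Omega>) f v
          - complex_of_real (k\<^sup>2 * \<epsilon>) * L2_ip (lebesgue_on \<Omega>) (kerr D a a) v"
      using f kerr_L2(1)[OF a a(1)] H1_L2[OF v]
      by (simp only: L2_ip_diff_left L2_cmult L2_ip_cmult_left)
    then show ?thesis unfolding L2_ip_D_kerr data_rhs_def by simp
  qed
  ultimately show ?thesis
    unfolding iteration_step_def linearized_solution_def helm_solves_def by auto
qed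

text \<open>\<open>R\<close> is the pointwise source left over when two steps, from a and from b,
  are subtracted, with c the result of the second. Write \<delta> = |a|^2 - |b|^2, bounded by 2 B |a
  - b|. In general the terms 2 \<delta> c, \<delta> b and |a|^2 (a - b) contribute 4 + 2 + 1. If c
  is a or b, one \<delta> term cancels half of 2 \<delta> c, leaving 2 + 1.\<close>

lemma kerr_difference:
  assumes "cmod a \<le> B" "cmod b \<le> B" "cmod c \<le> B"
  defines "R \<equiv> 2 * (complex_of_real ((cmod a)\<^sup>2) - complex_of_real ((cmod b)\<^sup>2)) * c
      - complex_of_real ((cmod a)\<^sup>2) * a + complex_of_real ((cmod b)\<^sup>2) * b"
  shows "cmod R \<le> 7 * B\<^sup>2 * cmod (a - b)"
    and "c = a \<or> c = b \<Longrightarrow> cmod R \<le> 3 * B\<^sup>2 * cmod (a - b)"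
proof -
  have B: "0 \<le> B" using assms(1) norm_ge_zero[of a] by linarith
  define \<delta> where "\<delta> = complex_of_real ((cmod a)\<^sup>2) - complex_of_real ((cmod b)\<^sup>2)"
  have \<delta>: "cmod \<delta> \<le> 2 * B * cmod (a - b)"
  proof -
    have "cmod \<delta> = \<bar>cmod a - cmod b\<bar> * (cmod a + cmod b)"
      unfolding \<delta>_def of_real_diff[symmetric] norm_of_real square_diff_square_factored power2_eq_square
      by (simp add: abs_mult)
    also have "\<dots> \<le> cmod (a - b) * (2 * B)"
      using assms(1,2) by (intro mult_mono norm_triangle_ineq3) auto
    finally show ?thesis by (simp add: ac_simps)
  qed
  have \<delta>_mult: "cmod (\<delta> * z) \<le> 2 * B\<^sup>2 * cmod (a - b)" if "cmod z \<le> B" for z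
    using mult_mono[OF \<delta> that] B by (simp add: norm_mult power2_eq_square ac_simps)
  have sq_mult: "cmod (complex_of_real ((cmod z)\<^sup>2) * (a - b)) \<le> B\<^sup>2 * cmod (a - b)" if "cmod z \<le> B" for z
    using that unfolding norm_mult norm_of_real by (intro mult_right_mono) (auto intro: power_mono)
  have R: "R = 2 * (\<delta> * c) - (\<delta> * b + complex_of_real ((cmod a)\<^sup>2) * (a - b))"
    unfolding R_def \<delta>_def by (simp add: algebra_simps)
  have "cmod R \<le> 2 * cmod (\<delta> * c) + (cmod (\<delta> * b) + cmod (complex_of_real ((cmod a)\<^sup>2) * (a - b)))"
    unfolding R by (intro order_trans[OF norm_triangle_ineq4] add_mono norm_triangle_ineq) (simp add: norm_mult)
  also have "\<dots> \<le> 2 * (2 * B\<^sup>2 * cmod (a - b)) + (2 * B\<^sup>2 * cmod (a - b) + B\<^sup>2 * cmod (a - b))"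
    using assms by (intro add_mono mult_left_mono \<delta>_mult sq_mult) auto
  finally show "cmod R \<le> 7 * B\<^sup>2 * cmod (a - b)" by (simp add: ac_simps)
  assume "c = a \<or> c = b"
  then have "cmod R \<le> 2 * B\<^sup>2 * cmod (a - b) + B\<^sup>2 * cmod (a - b)"
  proof
    assume "c = a"
    then have "R = \<delta> * a - complex_of_real ((cmod b)\<^sup>2) * (a - b)"
      unfolding R_def \<delta>_def by (simp add: algebra_simps)
    then have "cmod R \<le> cmod (\<delta> * a) + cmod (complex_of_real ((cmod b)\<^sup>2) * (a - b))"
      by (simp only: norm_triangle_ineq4)
    then show ?thesis
      using \<delta>_mult[OF assms(1)] sq_mult[OF assms(2)] by linarith
  next
    assume "c = b"
    then have "R = \<delta> * b - complex_of_real ((cmod a)\<^sup>2) * (a - b)"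
      unfolding R_def \<delta>_def by (simp add: algebra_simps)
    then have "cmod R \<le> cmod (\<delta> * b) + cmod (complex_of_real ((cmod a)\<^sup>2) * (a - b))"
      by (simp only: norm_triangle_ineq4)
    then show ?thesis
      using \<delta>_mult[OF assms(2)] sq_mult[OF assms(1)] by linarith
  qed
  then show "cmod R \<le> 3 * B\<^sup>2 * cmod (a - b)" by (simp add: ac_simps)
qed

end

section \<open>The iteration\<close>

locale kerr_iteration = kerr_domain \<Omega> D for \<Omega> D :: "(real ^ 'n::finite) set" +
  fixes f g :: "real ^ 'n \<Rightarrow> complex" and k0 k \<epsilon> \<theta>1 C1 C2 Cinf q :: real
  assumes dim: "CARD('n) = 2 \<or> CARD('n) = 3"
    and f: "f \<in> L2 (lebesgue_on \<Omega>)" and g: "g \<in> Hhalf \<Omega>"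
    and k0: "0 < k0" "k0 \<le> k" and \<epsilon>: "0 < \<epsilon>"
    and C1: "0 < C1" and Cinf: "0 < Cinf"
    and stability: "linearized_stability \<Omega> D k0 \<theta>1 C1 C2 Cinf"
    and q: "q < 1 / 6" "q < C1 * \<theta>1 / 2"
    and small: "C1 * Cinf\<^sup>2 * k ^ (CARD('n) - 2) * \<epsilon> * (C_data \<Omega> f g)\<^sup>2 \<le> q * (1 - q)\<^sup>2"
begin

abbreviation "E \<equiv> C_data \<Omega> f g"

text \<open>The wave number factor of the L^\<infinity> stability bound; k P^2 = k^(d - 2) is the
  power in the smallness condition.\<close>

definition "P = k powr ((real CARD('n) - 3) / 2)"

text \<open>The L^\<infinity> stability bound for a problem with data at most
  \<open>E / (1 - q)\<close>.\<close>

definition "B = Cinf * P * E / (1 - q)"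

lemma k_pos: "0 < k"
  using k0 by simp

lemma B_nonneg: "0 \<le> B"
  using Cinf q by (simp add: B_def P_def C_data_nonneg)

lemma B_small: "C1 * (k * \<epsilon> * B\<^sup>2) \<le> q"
proof -
  have "k * P\<^sup>2 = k powr (real CARD('n) - 2)"
    using powr_add[of k 1 "real CARD('n) - 3"] k_pos
    by (simp add: P_def powr_power powr_half_sqrt power2_eq_square flip: powr_add)
  \<comment> \<open>The subtraction of naturals is exact because the dimension is 2 or 3.\<close>
  also have "\<dots> = k ^ (CARD('n) - 2)"
    using dim k_pos by (subst powr_realpow[symmetric]) (auto simp: of_nat_diff)
  finally have "C1 * (k * \<epsilon> * B\<^sup>2)
      = (C1 * Cinf\<^sup>2 * k ^ (CARD('n) - 2) * \<epsilon> * E\<^sup>2) / (1 - q)\<^sup>2"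
    by (simp add: B_def power_mult_distrib power_divide field_simps)
  also have "\<dots> \<le> q"
    using small q by (subst pos_divide_le_eq) auto
  finally show ?thesis .
qed

text \<open>The hypotheses bound \<open>q\<close> only from above; its sign comes from the left side
  of \<open>B_small\<close>.\<close>

lemma q_nonneg: "0 \<le> q"
  using order_trans[OF _ B_small] C1 k_pos \<epsilon> by simp

lemma B_small_theta: "k * (2 * \<epsilon>) * B\<^sup>2 \<le> \<theta>1"
proof -
  have "C1 * (k * (2 * \<epsilon>) * B\<^sup>2) \<le> C1 * \<theta>1"
    using B_small q(2) by simp
  then show ?thesis using C1 by simp
qed

text \<open>The stability hypothesis bounds one particular solution. Uniqueness almost everywhere
  transfers the bounds to every representative, and in particular to the iterates, which are
  arbitrary solutions.\<close>

lemma linearized_solution_stability: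
  assumes a: "a \<in> H1 \<Omega>" "bounded_on_D B a"
    and F: "F \<in> L2 (lebesgue_on \<Omega>)" and h: "h \<in> Hhalf \<Omega>"
  shows "\<exists>w. linearized_solution \<Omega> D k (2 * \<epsilon>) a F h w"
    and "linearized_solution \<Omega> D k (2 * \<epsilon>) a F h w \<Longrightarrow>
      H1k_norm \<Omega> k w \<le> C1 * C_data \<Omega> F h \<and> bounded_on_D (Cinf * P * C_data \<Omega> F h) w"
proof -
  note Linf = bounded_on_D_imp_Linf[OF L2_measurable[OF H1_L2[OF a(1)]] a(2) B_nonneg]
  have norm_a: "0 \<le> Linf_norm (lebesgue_on D) a"
    by (rule Linf_norm_nonneg[OF measurable_on_D[OF L2_measurable[OF H1_L2[OF a(1)]]]])
  have "k * (2 * \<epsilon>) * (Linf_norm (lebesgue_on D) a)\<^sup>2 \<le> k * (2 * \<epsilon>) * B\<^sup>2"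
    using Linf(2) norm_a B_nonneg k_pos \<epsilon> by (intro mult_left_mono) (auto intro: power_mono)
  also note B_small_theta
  finally obtain w0 where w0: "linearized_solution \<Omega> D k (2 * \<epsilon>) a F h w0"
    "\<And>w'. linearized_solution \<Omega> D k (2 * \<epsilon>) a F h w' \<Longrightarrow> (AE x in lebesgue_on \<Omega>. w' x = w0 x)"
    "H1k_norm \<Omega> k w0 \<le> C1 * C_data \<Omega> F h"
    "w0 \<in> Linf (lebesgue_on D)"
    "Linf_norm (lebesgue_on D) w0 \<le> Cinf * P * C_data \<Omega> F h"
    using stability[unfolded linearized_stability_def, rule_format, of k "2 * \<epsilon>" a F h]
      k0 \<epsilon> a(1) Linf(1) F h unfolding P_def by auto
  show "\<exists>w. linearized_solution \<Omega> D k (2 * \<epsilon>) a F h w" using w0(1) by blast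
  assume w: "linearized_solution \<Omega> D k (2 * \<epsilon>) a F h w"
  have H1: "w \<in> H1 \<Omega>" "w0 \<in> H1 \<Omega>"
    using w w0(1) by (auto simp: linearized_solution_def helm_solves_def)
  have eq: "AE x in lebesgue_on \<Omega>. w x = w0 x" by (rule w0(2)[OF w])
  have "H1k_norm \<Omega> k w = H1k_norm \<Omega> k w0"
    using H1 eq by (intro H1k_norm_cong_AE L2_measurable H1_L2)
  moreover have "bounded_on_D (Cinf * P * C_data \<Omega> F h) w"
    using Linf_imp_bounded_on_D[OF w0(4,5)] eq unfolding bounded_on_D_def
    by eventually_elim simp
  ultimately show "H1k_norm \<Omega> k w \<le> C1 * C_data \<Omega> F h \<and> bounded_on_D (Cinf * P * C_data \<Omega> F h) w"
    using w0(3) by simp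
qed

text \<open>Besides the bound on D, the size of the cubic source
  \<open>k\<^sup>2 * \<epsilon> * |a|\<^sup>2 * a\<close> requires control of k times the L^2 norm;
  both bounds correspond to data of size \<open>E / (1 - q)\<close>, which one step
  reproduces.\<close>

definition admissible :: "(real ^ 'n \<Rightarrow> complex) \<Rightarrow> bool" where
  "admissible a \<longleftrightarrow> a \<in> H1 \<Omega> \<and> bounded_on_D B a \<and> k * L2_norm (lebesgue_on \<Omega>) a \<le> C1 * E / (1 - q)"

abbreviation step :: "(real ^ 'n \<Rightarrow> complex) \<Rightarrow> (real ^ 'n \<Rightarrow> complex) \<Rightarrow> bool" where
  "step \<equiv> iteration_step \<Omega> D k \<epsilon> f g"

lemma source_L2:
  assumes "a \<in> H1 \<Omega>" "bounded_on_D B a"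
  shows "(\<lambda>x. f x - complex_of_real (k\<^sup>2 * \<epsilon>) * kerr D a a x) \<in> L2 (lebesgue_on \<Omega>)"
  using kerr_L2(1)[OF H1_L2[OF assms(1)] assms(2) H1_L2[OF assms(1)]]
  by (intro L2_diff f L2_cmult)

lemma step_exists:
  assumes a: "a \<in> H1 \<Omega>" "bounded_on_D B a"
  shows "\<exists>w. step a w"
  using linearized_solution_stability(1)[OF a source_L2[OF a] g]
  by (simp add: iteration_step_iff[OF H1_L2[OF a(1)] a(2) f])

lemma step_H1: "step a w \<Longrightarrow> w \<in> H1 \<Omega>"
  by (simp add: iteration_step_def helm_solves_def)

lemma step_admissible:
  assumes a: "admissible a" and w: "step a w"
  shows "admissible w"
proof -
  let ?M = "lebesgue_on \<Omega>"
  have a': "a \<in> H1 \<Omega>" "bounded_on_D B a" and a_norm: "k * L2_norm ?M a \<le> C1 * E / (1 - q)"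
    using a by (auto simp: admissible_def)
  let ?F = "\<lambda>x. f x - complex_of_real (k\<^sup>2 * \<epsilon>) * kerr D a a x"
  note lin = w[unfolded iteration_step_iff[OF H1_L2[OF a'(1)] a'(2) f]]
  note kerr = kerr_L2[OF H1_L2[OF a'(1)] a'(2) H1_L2[OF a'(1)]]
  have "L2_norm ?M ?F \<le> L2_norm ?M f + k\<^sup>2 * \<epsilon> * L2_norm ?M (kerr D a a)"
    using L2_norm_diff_triangle[OF f L2_cmult[OF kerr(1), of "complex_of_real (k\<^sup>2 * \<epsilon>)"]] \<epsilon>
    unfolding L2_norm_cmult norm_of_real by simp
  also have "\<dots> \<le> L2_norm ?M f + k\<^sup>2 * \<epsilon> * (B\<^sup>2 * L2_norm ?M a)"
    using kerr(2) \<epsilon> by (intro add_left_mono mult_left_mono) auto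
  \<comment> \<open>One factor k is absorbed by the smallness of
    \<open>k * \<epsilon> * B\<^sup>2\<close>, the other by the weighted L^2 bound of an admissible
    function.\<close>
  also have "k\<^sup>2 * \<epsilon> * (B\<^sup>2 * L2_norm ?M a) = (k * \<epsilon> * B\<^sup>2) * (k * L2_norm ?M a)"
    by (simp add: power2_eq_square)
  also have "\<dots> \<le> (k * \<epsilon> * B\<^sup>2) * (C1 * E / (1 - q))"
    using k_pos \<epsilon> by (intro mult_left_mono a_norm) auto
  also have "\<dots> = C1 * (k * \<epsilon> * B\<^sup>2) * (E / (1 - q))" by simp
  also have "\<dots> \<le> q * (E / (1 - q))"
    using q by (intro mult_right_mono B_small divide_nonneg_nonneg C_data_nonneg) auto
  finally have "C_data \<Omega> ?F g \<le> E + q * (E / (1 - q))"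
    by (simp add: C_data_def)
  also have "\<dots> = E / (1 - q)" using q by (simp add: field_simps)
  finally have data: "C_data \<Omega> ?F g \<le> E / (1 - q)" .
  note st = linearized_solution_stability(2)[OF a' source_L2[OF a'] g lin]
  have "k * L2_norm ?M w \<le> C1 * (E / (1 - q))"
    using L2_norm_le_H1k_norm[of k \<Omega> w] st mult_left_mono[OF data, of C1] C1 by linarith
  moreover have "Cinf * P * C_data \<Omega> ?F g \<le> B"
    using mult_left_mono[OF data, of "Cinf * P"] Cinf by (simp add: B_def P_def)
  then have "bounded_on_D B w"
    using st unfolding bounded_on_D_def by (auto elim!: eventually_mono)
  ultimately show ?thesis using step_H1[OF w] by (simp add: admissible_def)
qed

text \<open>Keeping the coefficient at a, write 2 |a|^2 a' - 2 |b|^2 b' = 2 |a|^2 (a' - b') + 2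
  (|a|^2 - |b|^2) b'. The first term stays in the linearized operator and the second joins the
  source \<open>R\<close>, which is why the bound on D is demanded of b'.\<close>

lemma step_difference:
  assumes a: "a \<in> H1 \<Omega>" "bounded_on_D B a" and b: "b \<in> H1 \<Omega>" "bounded_on_D B b"
    and steps: "step a a'" "step b b'" and b': "bounded_on_D B b'"
  shows "H1k_norm \<Omega> k (\<lambda>x. a' x - b' x) \<le> 7 * q * (k * L2_norm (lebesgue_on \<Omega>) (\<lambda>x. a x - b x))"
    and "b' = a \<or> b' = b \<Longrightarrow>
      H1k_norm \<Omega> k (\<lambda>x. a' x - b' x) \<le> 3 * q * (k * L2_norm (lebesgue_on \<Omega>) (\<lambda>x. a x - b x))"
proof -
  let ?M = "lebesgue_on \<Omega>" and ?c = "complex_of_real (k\<^sup>2 * \<epsilon>)"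
    and ?c2 = "complex_of_real (k\<^sup>2 * (2 * \<epsilon>))"
  note aL = H1_L2[OF a(1)] and bL = H1_L2[OF b(1)]
  note a'H = step_H1[OF steps(1)] and b'H = step_H1[OF steps(2)]
  note kerr_a = kerr_L2(1)[OF aL a(2)] and kerr_b = kerr_L2(1)[OF bL b(2)]
  define R where "R x = ?c2 * kerr D a b' x - ?c2 * kerr D b b' x - ?c * kerr D a a x + ?c * kerr D b b x" for x
  have R: "R \<in> L2 ?M"
    unfolding R_def[abs_def]
    by (intro L2_add L2_diff L2_cmult kerr_a kerr_b aL bL H1_L2[OF b'H])
  have sa: "helmholtz_source \<Omega> k (\<lambda>x. f x - ?c * kerr D a a x + ?c2 * kerr D a a' x) g a'"
    using steps(1) unfolding iteration_step_iff[OF aL a(2) f]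
      linearized_solution_iff[OF aL a(2) source_L2[OF a]] by simp
  have sb: "helmholtz_source \<Omega> k (\<lambda>x. f x - ?c * kerr D b b x + ?c2 * kerr D b b' x) g b'"
    using steps(2) unfolding iteration_step_iff[OF bL b(2) f]
      linearized_solution_iff[OF bL b(2) source_L2[OF b]] by simp
  have La: "(\<lambda>x. f x - ?c * kerr D a a x + ?c2 * kerr D a a' x) \<in> L2 ?M"
    by (intro L2_add source_L2[OF a] L2_cmult kerr_a H1_L2[OF a'H])
  have Lb: "(\<lambda>x. f x - ?c * kerr D b b x + ?c2 * kerr D b b' x) \<in> L2 ?M"
    by (intro L2_add source_L2[OF b] L2_cmult kerr_b H1_L2[OF b'H])
  have "(\<lambda>x. (f x - ?c * kerr D a a x + ?c2 * kerr D a a' x) - (f x - ?c * kerr D b b x + ?c2 * kerr D b b' x))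
      = (\<lambda>x. R x + ?c2 * kerr D a (\<lambda>x. a' x - b' x) x)"
    by (rule ext) (simp add: R_def kerr_def algebra_simps)
  then have lin: "linearized_solution \<Omega> D k (2 * \<epsilon>) a R (\<lambda>x. 0) (\<lambda>x. a' x - b' x)"
    using helmholtz_source_diff[OF open_Omega bounded_Omega sa sb La Lb]
      H1_diff[OF open_Omega bounded_Omega a'H b'H]
    unfolding linearized_solution_iff[OF aL a(2) R] by simp
  have bound: "H1k_norm \<Omega> k (\<lambda>x. a' x - b' x) \<le> C1 * L2_norm ?M R"
    using linearized_solution_stability(2)[OF a R Hhalf_zero lin] by simp
  \<comment> \<open>Proved for a general factor \<kappa>, to be instantiated with 7 and with
    3.\<close>
  have est: "H1k_norm \<Omega> k (\<lambda>x. a' x - b' x) \<le> \<kappa> * q * (k * L2_norm ?M (\<lambda>x. a x - b x))"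
    if \<kappa>: "0 \<le> \<kappa>" and le: "AE x in ?M. x \<in> D \<longrightarrow>
        cmod (2 * (complex_of_real ((cmod (a x))\<^sup>2) - complex_of_real ((cmod (b x))\<^sup>2)) * b' x
          - complex_of_real ((cmod (a x))\<^sup>2) * a x + complex_of_real ((cmod (b x))\<^sup>2) * b x)
        \<le> \<kappa> * B\<^sup>2 * cmod (a x - b x)" for \<kappa>
  proof -
    have "AE x in ?M. cmod (R x) \<le> k\<^sup>2 * \<epsilon> * (\<kappa> * B\<^sup>2) * cmod (a x - b x)"
      using le
    proof eventually_elim
      case (elim x)
      have "R x = complex_of_real (indicator D x) * ?c *
          (2 * (complex_of_real ((cmod (a x))\<^sup>2) - complex_of_real ((cmod (b x))\<^sup>2)) * b' x
          - complex_of_real ((cmod (a x))\<^sup>2) * a x + complex_of_real ((cmod (b x))\<^sup>2) * b x)"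
        by (simp add: R_def kerr_def algebra_simps)
      then show ?case
        using elim \<epsilon> \<kappa>
        by (cases "x \<in> D")
          (auto simp: norm_mult norm_power mult.assoc simp del: of_real_power intro!: mult_left_mono)
    qed
    then have "L2_norm ?M R \<le> k\<^sup>2 * \<epsilon> * (\<kappa> * B\<^sup>2) * L2_norm ?M (\<lambda>x. a x - b x)"
      using \<kappa> \<epsilon> by (intro L2_bounded(2)[OF L2_diff[OF aL bL] L2_measurable[OF R]]) simp_all
    then have "C1 * L2_norm ?M R \<le> C1 * (k\<^sup>2 * \<epsilon> * (\<kappa> * B\<^sup>2) * L2_norm ?M (\<lambda>x. a x - b x))"
      using C1 by (intro mult_left_mono) auto
    also have "\<dots> = C1 * (k * \<epsilon> * B\<^sup>2) * (\<kappa> * (k * L2_norm ?M (\<lambda>x. a x - b x)))"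
      by (simp add: power2_eq_square)
    also have "\<dots> \<le> q * (\<kappa> * (k * L2_norm ?M (\<lambda>x. a x - b x)))"
      using \<kappa> k_pos by (intro mult_right_mono B_small mult_nonneg_nonneg L2_norm_nonneg) auto
    finally show ?thesis using bound by (simp add: ac_simps)
  qed
  have bd: "AE x in ?M. x \<in> D \<longrightarrow> cmod (a x) \<le> B \<and> cmod (b x) \<le> B \<and> cmod (b' x) \<le> B"
    using a(2) b(2) b' unfolding bounded_on_D_def by eventually_elim simp
  show "H1k_norm \<Omega> k (\<lambda>x. a' x - b' x) \<le> 7 * q * (k * L2_norm ?M (\<lambda>x. a x - b x))"
    by (rule est[OF _ eventually_mono[OF bd]]) (simp, blast intro: kerr_difference(1))
  assume eq: "b' = a \<or> b' = b"
  show "H1k_norm \<Omega> k (\<lambda>x. a' x - b' x) \<le> 3 * q * (k * L2_norm ?M (\<lambda>x. a x - b x))"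
    by (rule est[OF _ eventually_mono[OF bd]]) (simp, use eq in \<open>blast intro: kerr_difference(2)\<close>)
qed

text \<open>The alternative \<open>b' = a\<close> is the case of consecutive iterates,
  \<open>b' = b\<close> that of an iterate compared with a fixed point. In both the factor is 3 q <
  1/2.\<close>

lemma step_contraction:
  assumes "a \<in> H1 \<Omega>" "bounded_on_D B a" "b \<in> H1 \<Omega>" "bounded_on_D B b"
    and "step a a'" "step b b'" and "b' = a \<or> b' = b"
  shows "H1k_norm \<Omega> k (\<lambda>x. a' x - b' x) \<le> 1 / 2 * H1k_norm \<Omega> k (\<lambda>x. a x - b x)"
proof -
  have "bounded_on_D B b'" using assms(2,4,7) by auto
  then have "H1k_norm \<Omega> k (\<lambda>x. a' x - b' x) \<le> 3 * q * (k * L2_norm (lebesgue_on \<Omega>) (\<lambda>x. a x - b x))"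
    using assms by (intro step_difference(2)) auto
  also have "\<dots> \<le> 3 * q * H1k_norm \<Omega> k (\<lambda>x. a x - b x)"
    using q_nonneg by (intro mult_left_mono L2_norm_le_H1k_norm) auto
  also have "\<dots> \<le> 1 / 2 * H1k_norm \<Omega> k (\<lambda>x. a x - b x)"
    using q by (intro mult_right_mono H1k_norm_nonneg) auto
  finally show ?thesis .
qed

section \<open>Iterates, fixed point and linear convergence\<close>

lemma admissible_zero: "admissible (\<lambda>x. 0)"
  using B_nonneg C1 q by (simp add: admissible_def H1_zero bounded_on_D_def C_data_nonneg)

lemma iteration_exists: "\<exists>U. iteration \<Omega> D k \<epsilon> f g U"
proof -
  have "\<exists>w. admissible w \<and> step a w" if "admissible a" for a
    using step_exists[of a] step_admissible[OF that] that by (auto simp: admissible_def)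
  then obtain U where "U 0 = (\<lambda>x. 0)" "\<And>n. step (U n) (U (Suc n))"
    \<comment> \<open>Admissibility is carried along because it guarantees that the next step is
      solvable; the implication for \<open>n = 0\<close> pins the starting value.\<close>
    using dependent_nat_choice[of "\<lambda>n a. admissible a \<and> (n = 0 \<longrightarrow> a = (\<lambda>x. 0))" "\<lambda>n. step"]
      admissible_zero by (metis nat.distinct(1))
  then have "iteration \<Omega> D k \<epsilon> f g U"
    unfolding iteration_def by (metis One_nat_def Suc_diff_1 Suc_le_eq)
  then show ?thesis by blast
qed

lemma iteration_step_Suc: "iteration \<Omega> D k \<epsilon> f g U \<Longrightarrow> step (U l) (U (Suc l))"
  unfolding iteration_def by (metis diff_Suc_1 le_add1 plus_1_eq_Suc)

lemma iteration_admissible: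
  assumes U: "iteration \<Omega> D k \<epsilon> f g U" shows "admissible (U l)"
proof (induction l)
  case 0
  then show ?case using U admissible_zero by (simp add: iteration_def)
next
  case (Suc l)
  then show ?case by (rule step_admissible[OF _ iteration_step_Suc[OF U]])
qed

lemma iteration_contraction:
  assumes U: "iteration \<Omega> D k \<epsilon> f g U"
  shows "H1k_norm \<Omega> k (\<lambda>x. U (Suc (Suc l)) x - U (Suc l) x)
    \<le> 1 / 2 * H1k_norm \<Omega> k (\<lambda>x. U (Suc l) x - U l x)"
  using iteration_admissible[OF U, of l] iteration_admissible[OF U, of "Suc l"]
    iteration_step_Suc[OF U, of l] iteration_step_Suc[OF U, of "Suc l"]
  by (intro step_contraction) (auto simp: admissible_def)

text \<open>At a fixed point the coefficient 2 of the linearization and the -1 of the explicit cubic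
  source add up to the coefficient 1 of the nonlinear problem.\<close>

lemma nonlinear_solution_iff_step:
  assumes u: "u \<in> H1 \<Omega>" "bounded_on_D B u"
  shows "nonlinear_solution \<Omega> D k \<epsilon> f g u \<longleftrightarrow> step u u"
proof -
  have "(\<lambda>x. f x - complex_of_real (k\<^sup>2 * \<epsilon>) * kerr D u u x + complex_of_real (k\<^sup>2 * (2 * \<epsilon>)) * kerr D u u x)
      = (\<lambda>x. f x + complex_of_real (k\<^sup>2 * \<epsilon>) * kerr D u u x)"
    by (simp add: algebra_simps)
  then show ?thesis
    unfolding iteration_step_iff[OF H1_L2[OF u(1)] u(2) f]
      linearized_solution_iff[OF H1_L2[OF u(1)] u(2) source_L2[OF u]]
      nonlinear_solution_def linearized_solution_def[symmetric]
      linearized_solution_iff[OF H1_L2[OF u(1)] u(2) f] by simp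
qed

text \<open>The limit \<open>h\<close> of the iterates is not shown to solve the nonlinear problem directly, which
  would need convergence of the traces.  Instead one step of the iteration from \<open>h\<close> gives a function
  \<open>w\<close>, with its trace, that agrees with \<open>h\<close> almost everywhere.\<close>

lemma fixed_point_exists: "\<exists>u. u \<in> H1 \<Omega> \<and> bounded_on_D B u \<and> step u u"
proof -
  let ?M = "lebesgue_on \<Omega>"
  obtain U where U: "iteration \<Omega> D k \<epsilon> f g U" using iteration_exists by blast
  note adm = iteration_admissible[OF U, unfolded admissible_def]
  define K where "K = H1k_norm \<Omega> k (\<lambda>x. U 1 x - U 0 x)"
  have geo: "H1k_norm \<Omega> k (\<lambda>x. U (Suc l) x - U l x) \<le> K * (1/2) ^ l" for l
  proof (induction l)
    case (Suc l)
    then show ?case using iteration_contraction[OF U, of l] by simp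
  qed (simp add: K_def)
  obtain h where h: "h \<in> H1 \<Omega>" "AE x in ?M. (\<lambda>n. U n x) \<longlonglongrightarrow> h x"
    "(\<lambda>n. L2_norm ?M (\<lambda>x. U n x - h x)) \<longlonglongrightarrow> 0"
    using H1_geometric_limit[OF open_Omega bounded_Omega k_pos _ geo] adm by blast
  \<comment> \<open>The bound on D survives because the iterates converge pointwise almost
    everywhere; L^2 convergence alone would not give it directly.\<close>
  have h_bound: "bounded_on_D B h"
  proof -
    have "AE x in ?M. \<forall>n. x \<in> D \<longrightarrow> cmod (U n x) \<le> B"
      unfolding AE_all_countable using adm by (simp add: bounded_on_D_def)
    with h(2) have "AE x in ?M. x \<in> D \<longrightarrow> cmod (h x) \<le> B"
      by eventually_elim (auto intro: LIMSEQ_le_const2[OF tendsto_norm])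
    then show ?thesis by (simp add: bounded_on_D_def)
  qed
  obtain w where w: "step h w" using step_exists[OF h(1) h_bound] by blast
  note wH = step_H1[OF w]
  have UL: "U n \<in> L2 ?M" for n using adm[of n] by (simp add: H1_L2)
  \<comment> \<open>The steps from h to w and from \<open>U n\<close> to \<open>U (Suc n)\<close>
    are compared. Neither starting point need be \<open>U (Suc n)\<close>, so only the factor 7 q is
    available; this is enough since both distances on the right tend to 0.\<close>
  have bound: "L2_norm ?M (\<lambda>x. w x - h x)
      \<le> 7 * q * L2_norm ?M (\<lambda>x. U n x - h x) + L2_norm ?M (\<lambda>x. U (Suc n) x - h x)" for n
  proof -
    have "k * L2_norm ?M (\<lambda>x. w x - U (Suc n) x) \<le> H1k_norm \<Omega> k (\<lambda>x. w x - U (Suc n) x)"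
      by (rule L2_norm_le_H1k_norm)
    also have "\<dots> \<le> 7 * q * (k * L2_norm ?M (\<lambda>x. h x - U n x))"
      using adm h_bound h(1) w iteration_step_Suc[OF U] by (intro step_difference(1)) auto
    finally have "k * L2_norm ?M (\<lambda>x. w x - U (Suc n) x) \<le> k * (7 * q * L2_norm ?M (\<lambda>x. U n x - h x))"
      by (simp add: L2_norm_minus_commute[of _ h] ac_simps)
    then have 1: "L2_norm ?M (\<lambda>x. w x - U (Suc n) x) \<le> 7 * q * L2_norm ?M (\<lambda>x. U n x - h x)"
      using k_pos by simp
    have "L2_norm ?M (\<lambda>x. w x - h x) = L2_norm ?M (\<lambda>x. (w x - U (Suc n) x) + (U (Suc n) x - h x))"
      by simp
    also have "\<dots> \<le> L2_norm ?M (\<lambda>x. w x - U (Suc n) x) + L2_norm ?M (\<lambda>x. U (Suc n) x - h x)"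
      by (intro L2_norm_triangle L2_diff UL H1_L2 wH h(1))
    finally show ?thesis using 1 by linarith
  qed
  have "(\<lambda>n. 7 * q * L2_norm ?M (\<lambda>x. U n x - h x) + L2_norm ?M (\<lambda>x. U (Suc n) x - h x)) \<longlonglongrightarrow> 7 * q * 0 + 0"
    by (intro tendsto_intros h(3) LIMSEQ_Suc[OF h(3)])
  then have "L2_norm ?M (\<lambda>x. w x - h x) \<le> 0"
    using bound by (intro LIMSEQ_le_const) auto
  then have "L2_norm ?M (\<lambda>x. w x - h x) = 0" using L2_norm_nonneg order_antisym by blast
  from L2_norm_eq_0_AE[OF L2_diff[OF H1_L2[OF wH] H1_L2[OF h(1)]] this]
  have eq: "AE x in ?M. w x = h x" by simp
  have w_bound: "bounded_on_D B w"
    using h_bound eq unfolding bounded_on_D_def by eventually_elim simp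
  let ?c = "complex_of_real (k\<^sup>2 * \<epsilon>)" and ?c2 = "complex_of_real (k\<^sup>2 * (2 * \<epsilon>))"
  note hL = H1_L2[OF h(1)] and wL = H1_L2[OF wH]
  have L2: "(\<lambda>x. f x - ?c * kerr D a a x + ?c2 * kerr D a w x) \<in> L2 ?M"
    if "a \<in> H1 \<Omega>" "bounded_on_D B a" for a
    by (intro L2_add source_L2[OF that] L2_cmult kerr_L2(1)[OF H1_L2[OF that(1)] that(2)] wL)
  \<comment> \<open>Replacing h by w in the coefficient and in the source changes them only on a
    null set, so the equation for w, with its trace unchanged, becomes a fixed point
    equation.\<close>
  have "helmholtz_source \<Omega> k (\<lambda>x. f x - ?c * kerr D h h x + ?c2 * kerr D h w x) g w"
    using w unfolding iteration_step_iff[OF hL h_bound f]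
      linearized_solution_iff[OF hL h_bound source_L2[OF h(1) h_bound]] by simp
  moreover have "AE x in ?M. f x - ?c * kerr D h h x + ?c2 * kerr D h w x
      = f x - ?c * kerr D w w x + ?c2 * kerr D w w x"
    using eq by eventually_elim (simp add: kerr_def)
  ultimately have "helmholtz_source \<Omega> k (\<lambda>x. f x - ?c * kerr D w w x + ?c2 * kerr D w w x) g w"
    using helmholtz_source_cong_AE[OF L2_measurable[OF L2[OF h(1) h_bound]]
        L2_measurable[OF L2[OF wH w_bound]]] by simp
  then have "step w w"
    unfolding iteration_step_iff[OF wL w_bound f]
      linearized_solution_iff[OF wL w_bound source_L2[OF wH w_bound]] using wH by simp
  then show ?thesis using wH w_bound by blast
qed

lemma iteration_converges_linearly:
  assumes U: "iteration \<Omega> D k \<epsilon> f g U"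
    and u: "u \<in> H1 \<Omega>" "bounded_on_D B u" "step u u"
  shows "converges_linearly (H1k_norm \<Omega> k) U u"
proof -
  have contr: "H1k_norm \<Omega> k (\<lambda>x. U (Suc l) x - u x) \<le> 1 / 2 * H1k_norm \<Omega> k (\<lambda>x. U l x - u x)" for l
    using iteration_admissible[OF U, of l] iteration_step_Suc[OF U, of l] u
    by (intro step_contraction) (auto simp: admissible_def)
  have "H1k_norm \<Omega> k (\<lambda>x. U l x - u x) \<le> H1k_norm \<Omega> k (\<lambda>x. U 0 x - u x) * (1/2) ^ l" for l
  proof (induction l)
    case (Suc l)
    then show ?case using contr[of l] by simp
  qed simp
  then have "(\<lambda>l. H1k_norm \<Omega> k (\<lambda>x. U l x - u x)) \<longlonglongrightarrow> 0"
    by (intro Lim_null_comparison[OF _ geometric_null[of "H1k_norm \<Omega> k (\<lambda>x. U 0 x - u x)"]])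
      (simp add: H1k_norm_nonneg)
  then show ?thesis
    unfolding converges_linearly_def using contr by (intro conjI exI[of _ "1/2"]) auto
qed

end

text \<open>Iterates are determined only almost everywhere, hence the quantification over all
  sequences \<open>U\<close>. The smallness condition is tied to \<open>\<theta>1\<close> through
  \<open>q\<close>, whereas known uniqueness is tied to \<open>\<theta>0\<close>; the limit is
  therefore constructed as a solution, and the last conjunct identifies it with the known
  one.\<close>

theorem proposition2p4:
  fixes \<Omega> D :: "(real ^ 'n::finite) set"
    and f g :: "real ^ 'n \<Rightarrow> complex"
    and k0 k \<epsilon> \<theta>1 C1 C2 Cinf q :: real
  assumes dim: "CARD('n) = 2 \<or> CARD('n) = 3"
    and Omega: "open \<Omega>" "bounded \<Omega>" "starlike \<Omega>" "analytic_boundary \<Omega>"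
    and D: "open D" "connected D" "D \<noteq> {}" "closure D \<subseteq> \<Omega>" "lipschitz_boundary D"
    and data: "f \<in> L2 (lebesgue_on \<Omega>)" "g \<in> Hhalf \<Omega>"
    and params: "0 < k0" "k0 \<le> k" "0 < \<epsilon>"
    and positive: "0 < \<theta>1" "0 < C1" "0 < C2" "0 < Cinf"
    and stability: "linearized_stability \<Omega> D k0 \<theta>1 C1 C2 Cinf"
    and q: "q < min (1 / 6) (C1 * \<theta>1 / 2)"
    and small: "C1 * Cinf\<^sup>2 * k ^ (CARD('n) - 2) * \<epsilon> * (C_data \<Omega> f g)\<^sup>2 \<le> q * (1 - q)\<^sup>2"
  shows "(\<exists>U. iteration \<Omega> D k \<epsilon> f g U) \<and>
    (\<exists>u. nonlinear_solution \<Omega> D k \<epsilon> f g u \<and>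
       (\<forall>U. iteration \<Omega> D k \<epsilon> f g U \<longrightarrow>
          (\<forall>l\<ge>1. H1k_norm \<Omega> k (\<lambda>x. U (l + 1) x - U l x)
                   \<le> 1 / 2 * H1k_norm \<Omega> k (\<lambda>x. U l x - U (l - 1) x)) \<and>
          converges_linearly (H1k_norm \<Omega> k) U u) \<and>
       (\<forall>\<theta>0 C. 0 < \<theta>0 \<and> nonlinear_well_posed \<Omega> D k0 \<theta>0 C \<and>
          k ^ (CARD('n) - 2) * \<epsilon> * (C_data \<Omega> f g)\<^sup>2 < \<theta>0 \<longrightarrow>
          (\<forall>u'. nonlinear_solution \<Omega> D k \<epsilon> f g u' \<longrightarrow> (AE x in lebesgue_on \<Omega>. u' x = u x))))"
proof -
  interpret kerr_iteration \<Omega> D f g k0 k \<epsilon> \<theta>1 C1 C2 Cinf q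
    using assms closure_subset[of D] by unfold_locales auto
  obtain u where u: "u \<in> H1 \<Omega>" "bounded_on_D B u" "step u u"
    using fixed_point_exists by blast
  then have sol: "nonlinear_solution \<Omega> D k \<epsilon> f g u"
    by (simp add: nonlinear_solution_iff_step)
  have contr: "H1k_norm \<Omega> k (\<lambda>x. U (l + 1) x - U l x) \<le> 1 / 2 * H1k_norm \<Omega> k (\<lambda>x. U l x - U (l - 1) x)"
    if "iteration \<Omega> D k \<epsilon> f g U" "1 \<le> l" for U l
    using iteration_contraction[OF that(1), of "l - 1"] that(2) by simp
  \<comment> \<open>Well-posedness supplies a reference solution \<open>v\<close> with which every
    solution agrees almost everywhere; applying this to \<open>u'\<close> and to the constructed
    \<open>u\<close> identifies them.\<close>
  have unique: "AE x in lebesgue_on \<Omega>. u' x = u x"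
    if wp: "nonlinear_well_posed \<Omega> D k0 \<theta>0 C" "k ^ (CARD('n) - 2) * \<epsilon> * (C_data \<Omega> f g)\<^sup>2 < \<theta>0"
      and u': "nonlinear_solution \<Omega> D k \<epsilon> f g u'" for \<theta>0 C u'
  proof -
    obtain v where v: "\<And>u'. nonlinear_solution \<Omega> D k \<epsilon> f g u' \<Longrightarrow> AE x in lebesgue_on \<Omega>. u' x = v x"
      using wp(1)[unfolded nonlinear_well_posed_def, rule_format, OF params(2,3) data wp(2)] by blast
    show ?thesis using v[OF u'] v[OF sol] by eventually_elim simp
  qed
  show ?thesis
    using iteration_exists sol contr unique iteration_converges_linearly[OF _ u] by blast
qed

end
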